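(* There is an absolute constant $c>0$ such that for every integer $q\geq 3$ there is an integer $p\geq q$ with the following property. Let $\mathcal{K}$ be a family of pairwise intersecting convex sets in $\mathbb{R}^3$. Then for every subfamily $\mathcal{A}\subseteq\mathcal{K}$ with $|\mathcal{A}|=p$, at least one of the following holds: (1) some three distinct sets $A,B,C\in\mathcal{A}$ can be crossed by a common vertical line, i.e. $A^*\cap B^*\cap C^*\neq\emptyset$; or (2) there is a sequence $K_1,\ldots,K_q$ of $q$ distinct elements of $\mathcal{A}$ that is realized by a monotone sequence of lines $\ell_1,\ldots,\ell_q$, and there is a single plane $\pi$ that separates at least $c\binom{q}{2}$ of the pairs $K_i,K_j$, $1\leq i<j\leq q$.
   Context: For $p\in\mathbb{R}^3$, $p^*$ denotes its vertical projection to $\mathbb{R}^2$, $\hat p$ the vertical line through $p$; for $A\subseteq\mathbb{R}^3$, $A^*=\{p^*:p\in A\}$ and $\hat A=\bigcup_{p\in A}\hat p$. For convex $A,B\subseteq\mathbb{R}^3$, $A\backsim B=\mathrm{conv}((A\cap\hat B)\cup(B\cap\hat A))$, and a plane $\pi$ separates $A$ and $B$ if $\pi$ intersects $A\backsim B$. A sequence $K_1,\ldots,K_q$ of convex sets in $\mathbb{R}^3$ is realized by non-vertical lines $\ell_1,\ldots,\ell_q$ with pairwise non-parallel projections if for all $i<j$ the projected segments $(K_i\cap\ell_i)^*$ and $(K_j\cap\ell_j)^*$ intersect. For two such lines $\ell_1,\ell_2$, $p(\ell_1,\ell_2)$ (resp. $p(\ell_2,\ell_1)$) is the point where the unique vertical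 line meeting both lines meets $\ell_1$ (resp. $\ell_2$); $\ell_1\prec\ell_2$ (resp. $\succ$) means $p(\ell_1,\ell_2)$ is strictly below (resp. above) $p(\ell_2,\ell_1)$; $\ell_1\preceq\ell_2$ (resp. $\succeq$) means $\ell_1\prec\ell_2$ (resp. $\succ$) or $\ell_1\cap\ell_2\neq\emptyset$. An ordered sequence of $q\geq3$ non-vertical lines in $\mathbb{R}^2$, no three concurrent, is a $q$-cap (resp. $q$-cup) if the slopes are strictly decreasing (resp. increasing) and for all $i<j<k$ the point $\ell_i\cap\ell_k$ lies above (resp. below) $\ell_j$. A sequence of non-vertical lines $\ell_1,\ldots,\ell_q$ in $\mathbb{R}^3$ is monotone if its projection $\ell_1^*,\ldots,\ell_q^*$ is a $q$-cap or a $q$-cup and either $\ell_1\preceq\cdots\preceq\ell_q$ or $\ell_1\succeq\cdots\succeq\ell_q$. *)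

theory Defs
  imports "HOL-Analysis.Analysis"
begin

definition vproj :: "real^3 \<Rightarrow> real^2" where
  "vproj p = vector [p $ 1, p $ 2]"

definition vline :: "real^3 \<Rightarrow> (real^3) set" where
  "vline p = {x. vproj x = vproj p}"

definition vcyl :: "(real^3) set \<Rightarrow> (real^3) set" where
  "vcyl A = (\<Union>p\<in>A. vline p)"

definition bridge :: "(real^3) set \<Rightarrow> (real^3) set \<Rightarrow> (real^3) set" where
  "bridge A B = convex hull ((A \<inter> vcyl B) \<union> (B \<inter> vcyl A))"

definition is_line :: "'a::euclidean_space set \<Rightarrow> bool" where
  "is_line L \<longleftrightarrow> affine L \<and> aff_dim L = 1"

definition is_plane :: "(real^3) set \<Rightarrow> bool" where
  "is_plane P \<longleftrightarrow> affine P \<and> aff_dim P = 2"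

definition separates :: "(real^3) set \<Rightarrow> (real^3) set \<Rightarrow> (real^3) set \<Rightarrow> bool" where
  "separates P A B \<longleftrightarrow> P \<inter> bridge A B \<noteq> {}"

definition nonvertical3 :: "(real^3) set \<Rightarrow> bool" where
  "nonvertical3 L \<longleftrightarrow> is_line L \<and> (\<nexists>p. L = vline p)"

definition nonvertical2 :: "(real^2) set \<Rightarrow> bool" where
  "nonvertical2 L \<longleftrightarrow> is_line L \<and> (\<nexists>a. L = {x. x $ 1 = a})"

text \<open>Sequences of length \<open>q\<close> are functions on \<open>nat\<close> whose relevant indices are \<open>{1..q}\<close>.\<close>

definition realized_by ::
  "nat \<Rightarrow> (nat \<Rightarrow> (real^3) set) \<Rightarrow> (nat \<Rightarrow> (real^3) set) \<Rightarrow> bool" where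
  "realized_by q K l \<longleftrightarrow>
     (\<forall>i\<in>{1..q}. nonvertical3 (l i)) \<and>
     (\<forall>i\<in>{1..q}. \<forall>j\<in>{1..q}. i < j \<longrightarrow>
        \<not> affine_parallel (vproj ` l i) (vproj ` l j) \<and>
        vproj ` (K i \<inter> l i) \<inter> vproj ` (K j \<inter> l j) \<noteq> {})"

text \<open>The point of \<open>L\<close> on the vertical line that meets both \<open>L\<close> and \<open>M\<close>; it is unique
  when \<open>L\<close> and \<open>M\<close> are non-vertical lines with non-parallel projections.\<close>

definition cross_pt :: "(real^3) set \<Rightarrow> (real^3) set \<Rightarrow> real^3" where
  "cross_pt L M = (THE p. p \<in> L \<and> vline p \<inter> M \<noteq> {})"

definition line_below :: "(real^3) set \<Rightarrow> (real^3) set \<Rightarrow> bool" where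
  "line_below L M \<longleftrightarrow> cross_pt L M $ 3 < cross_pt M L $ 3"

definition line_above :: "(real^3) set \<Rightarrow> (real^3) set \<Rightarrow> bool" where
  "line_above L M \<longleftrightarrow> cross_pt L M $ 3 > cross_pt M L $ 3"

definition line_below_eq :: "(real^3) set \<Rightarrow> (real^3) set \<Rightarrow> bool" where
  "line_below_eq L M \<longleftrightarrow> line_below L M \<or> L \<inter> M \<noteq> {}"

definition line_above_eq :: "(real^3) set \<Rightarrow> (real^3) set \<Rightarrow> bool" where
  "line_above_eq L M \<longleftrightarrow> line_above L M \<or> L \<inter> M \<noteq> {}"

definition slope :: "(real^2) set \<Rightarrow> real" where
  "slope L = (THE m. \<forall>x\<in>L. \<forall>y\<in>L. y $ 2 - x $ 2 = m * (y $ 1 - x $ 1))"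

definition pt_above :: "real^2 \<Rightarrow> (real^2) set \<Rightarrow> bool" where
  "pt_above x L \<longleftrightarrow> (\<exists>y\<in>L. y $ 1 = x $ 1 \<and> y $ 2 < x $ 2)"

definition pt_below :: "real^2 \<Rightarrow> (real^2) set \<Rightarrow> bool" where
  "pt_below x L \<longleftrightarrow> (\<exists>y\<in>L. y $ 1 = x $ 1 \<and> x $ 2 < y $ 2)"

definition simple_lines :: "nat \<Rightarrow> (nat \<Rightarrow> (real^2) set) \<Rightarrow> bool" where
  "simple_lines q m \<longleftrightarrow> q \<ge> 3 \<and> (\<forall>i\<in>{1..q}. nonvertical2 (m i)) \<and>
     (\<forall>i\<in>{1..q}. \<forall>j\<in>{1..q}. \<forall>k\<in>{1..q}. i < j \<and> j < k \<longrightarrow> m i \<inter> m j \<inter> m k = {})"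

definition is_cap :: "nat \<Rightarrow> (nat \<Rightarrow> (real^2) set) \<Rightarrow> bool" where
  "is_cap q m \<longleftrightarrow> simple_lines q m \<and>
     (\<forall>i\<in>{1..q}. \<forall>j\<in>{1..q}. i < j \<longrightarrow> slope (m j) < slope (m i)) \<and>
     (\<forall>i\<in>{1..q}. \<forall>j\<in>{1..q}. \<forall>k\<in>{1..q}. i < j \<and> j < k \<longrightarrow>
        (\<exists>x. m i \<inter> m k = {x} \<and> pt_above x (m j)))"

definition is_cup :: "nat \<Rightarrow> (nat \<Rightarrow> (real^2) set) \<Rightarrow> bool" where
  "is_cup q m \<longleftrightarrow> simple_lines q m \<and>
     (\<forall>i\<in>{1..q}. \<forall>j\<in>{1..q}. i < j \<longrightarrow> slope (m i) < slope (m j)) \<and>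
     (\<forall>i\<in>{1..q}. \<forall>j\<in>{1..q}. \<forall>k\<in>{1..q}. i < j \<and> j < k \<longrightarrow>
        (\<exists>x. m i \<inter> m k = {x} \<and> pt_below x (m j)))"

text \<open>The relations \<open>line_below_eq\<close> and \<open>line_above_eq\<close> are not transitive. The chain
  condition is imposed on consecutive lines, as in the usual meaning of
  \<open>l\<^sub>1 \<preceq> l\<^sub>2 \<preceq> \<dots> \<preceq> l\<^sub>q\<close>.\<close>

definition monotone_lines :: "nat \<Rightarrow> (nat \<Rightarrow> (real^3) set) \<Rightarrow> bool" where
  "monotone_lines q l \<longleftrightarrow>
     (\<forall>i\<in>{1..q}. nonvertical3 (l i)) \<and>
     (is_cap q (\<lambda>i. vproj ` l i) \<or> is_cup q (\<lambda>i. vproj ` l i)) \<and>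
     ((\<forall>i\<in>{1..<q}. line_below_eq (l i) (l (Suc i))) \<or>
      (\<forall>i\<in>{1..<q}. line_above_eq (l i) (l (Suc i))))"

end

theory Submission
  imports Defs "HOL-Library.Ramsey"
begin

text \<open>
  Vertical projection gives pairwise intersecting planar convex sets, no three with a common point.
  Ramsey's theorem extracts many of them that contain pairwise crossing segments. These are
  lifted to lines in space, and a further application makes the projected lines a cup or a cap and
  all pairs of lines comparable in the same direction.

  A plane through a fixed line \<open>h\<close> crosses the vertical segment joining a line \<open>i < h\<close> to a line
  \<open>j > h\<close> exactly when its angle lies in an interval \<open>[S h i j, S h j i]\<close>. Both end points are
  monotone, so all these intervals have a common point as soon as
  \<open>S h i' j' \<le> S h j i\<close> for \<open>i < i' < h < j < j'\<close>. Seven lines cannot violate this for three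
  consecutive choices of \<open>h\<close>, hence by Ramsey's theorem it may be assumed throughout, and one plane
  separates every pair with one member before \<open>h\<close> and one after it: about half of all pairs.
\<close>

section \<open>Homogeneous subsequences\<close>

text \<open>Each set receives one line only, so pairwise intersection points are not enough: a
  single segment per set has to meet the segments of all the other chosen sets. Being below is not
  transitive for lines in space, so heights are made uniform over all pairs and not just consecutive
  ones; the extrapolations below compare lines that are far apart. For one middle line the intervals
  need not have a common point: monotonicity leaves one comparison open, between extreme lower and
  upper ends, and it involves five lines. It can fail for some middle lines, and which ones is not
  known in advance; this is why quintuples are coloured. Afterwards any position may be taken as the
  middle, and the balanced one gives c = 1/2, since floor(q/2) * ceil(q/2) is at least half of
  q(q-1)/2. Three segments parallel to the second axis, and three lines of equal slope, are excluded
  by one observation: collinear intersection points of three convex sets force a point common to all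
  three.\<close>

lemma ramsey_increasing_lists:
  fixes r m :: nat
  shows "\<exists>N. \<forall>f :: nat list \<Rightarrow> 'c::finite. \<exists>e c. strict_mono_on {..<m} e \<and> (\<forall>i<m. e i < N) \<and>
           (\<forall>xs. length xs = r \<and> sorted_wrt (<) xs \<and> set xs \<subseteq> {..<m} \<longrightarrow> f (map e xs) = c)"
proof -
  obtain g :: "'c \<Rightarrow> nat" where g: "bij_betw g UNIV {..<CARD('c)}"
    using ex_bij_betw_finite_nat[of "UNIV :: 'c set"] by (auto simp: atLeast0LessThan)
  obtain N :: nat where N: "partn_lst {..<N} (replicate CARD('c) m) r"
    using ramsey_full by blast
  show ?thesis
  proof (intro exI[of _ N] allI)
    fix f :: "nat list \<Rightarrow> 'c"
    \<comment> \<open>A set is coloured through its increasing enumeration, so a colour may depend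
      on the order of the indices; \<open>g\<close> numbers the colours as the partition theorem
      demands.\<close>
    let ?f = "\<lambda>S. g (f (sorted_list_of_set S))"
    have "?f \<in> nsets {..<N} r \<rightarrow> {..<length (replicate CARD('c) m)}"
      using g by (auto simp: bij_betw_def)
    then obtain i where i: "i < CARD('c)" and "monochromatic {..<N} m r ?f i"
      using N unfolding partn_lst_def by fastforce
    then obtain H where H: "H \<subseteq> {..<N}" "finite H" "card H = m" and mono: "?f ` nsets H r \<subseteq> {i}"
      unfolding monochromatic_def nsets_def by auto
    define e where "e = (\<lambda>k. sorted_list_of_set H ! k)"
    have len: "length (sorted_list_of_set H) = m" using H by simp
    have e1: "strict_mono_on {..<m} e"
      using len strict_sorted_list_of_set[of H]
      by (auto simp: strict_mono_on_def e_def sorted_wrt_iff_nth_less)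
    have e2: "e k \<in> H" if "k < m" for k
      using that len H nth_mem[of k "sorted_list_of_set H"] by (simp add: e_def)
    obtain c where c: "g c = i"
      using g i by (metis bij_betw_def imageE lessThan_iff)
    have "f (map e xs) = c" if xs: "length xs = r" "sorted_wrt (<) xs" "set xs \<subseteq> {..<m}" for xs
    proof -
      have s: "sorted_wrt (<) (map e xs)"
        unfolding sorted_wrt_map
        by (rule sorted_wrt_mono_rel[OF _ xs(2)])
          (use xs(3) e1 in \<open>auto simp: strict_mono_on_def subset_iff\<close>)
      then have "sorted_list_of_set (set (map e xs)) = map e xs"
        by (metis sorted_list_of_set.idem_if_sorted_distinct strict_sorted_iff)
      moreover have "set (map e xs) \<in> nsets H r"
        using xs e2 distinct_card[of "map e xs"] s
        by (auto simp: nsets_def strict_sorted_iff subset_iff)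
      ultimately have "g (f (map e xs)) = i" using mono by fastforce
      then show ?thesis using c g by (metis bij_betw_def injD)
    qed
    then show "\<exists>e c. strict_mono_on {..<m} e \<and> (\<forall>i<m. e i < N) \<and>
           (\<forall>xs. length xs = r \<and> sorted_wrt (<) xs \<and> set xs \<subseteq> {..<m} \<longrightarrow> f (map e xs) = c)"
      using e1 e2 H(1) by (intro exI[of _ e] exI[of _ c]) auto
  qed
qed

text \<open>With an arbitrary finite colour type a tuple of truth values is one colour, so several
  order patterns become homogeneous at once. A pattern on pairs is coded by ignoring the third
  index, at the price of the last element.\<close>

lemma ramsey_triples:
  fixes m :: nat
  shows "\<exists>N. \<forall>f :: nat \<Rightarrow> nat \<Rightarrow> nat \<Rightarrow> 'c::finite. \<exists>e c. strict_mono_on {..<m} e \<and> (\<forall>i<m. e i < N) \<and>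
     (\<forall>i j k. i < j \<and> j < k \<and> k < m \<longrightarrow> f (e i) (e j) (e k) = c)"
  using ramsey_increasing_lists[of m 3, where ?'c = 'c]
  apply (elim exE)
  subgoal for N
    apply (rule exI[of _ N], rule allI)
    subgoal for f
      apply (drule spec[of _ "\<lambda>xs. f (xs!0) (xs!1) (xs!2)"], elim exE conjE)
      subgoal for e c
        apply (intro exI[of _ e] exI[of _ c] conjI, assumption, assumption, intro allI impI)
        subgoal for i j k
          by (drule spec[of _ "[i,j,k]"]) (simp add: numeral_eq_Suc)
        done
      done
    done
  done

lemma ramsey_quintuples:
  fixes m :: nat
  shows "\<exists>N. \<forall>P :: nat \<Rightarrow> nat \<Rightarrow> nat \<Rightarrow> nat \<Rightarrow> nat \<Rightarrow> bool. \<exists>e c. strict_mono_on {..<m} e \<and> (\<forall>i<m. e i < N) \<and>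
     (\<forall>i j k l n. i < j \<and> j < k \<and> k < l \<and> l < n \<and> n < m \<longrightarrow> P (e i) (e j) (e k) (e l) (e n) = c)"
  using ramsey_increasing_lists[of m 5, where ?'c = bool]
  apply (elim exE)
  subgoal for N
    apply (rule exI[of _ N], rule allI)
    subgoal for f
      apply (drule spec[of _ "\<lambda>xs. f (xs!0) (xs!1) (xs!2) (xs!3) (xs!4)"], elim exE conjE)
      subgoal for e c
        apply (intro exI[of _ e] exI[of _ c] conjI, assumption, assumption, intro allI impI)
        subgoal for i j k l n
          by (drule spec[of _ "[i,j,k,l,n]"]) (simp add: numeral_eq_Suc)
        done
      done
    done
  done

section \<open>Planes through a line of a monotone cup\<close>

text \<open>Line \<open>i\<close> is y = a i * x + b i, z = c i * x + d i. \<open>X i j\<close> is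
  the abscissa where the projections of \<open>i\<close> and \<open>j\<close> cross, and
  \<open>F i j\<close> is the height of line \<open>i\<close> over that crossing.\<close>

locale line_family =
  fixes a b c d :: "nat \<Rightarrow> real"
begin

definition X :: "nat \<Rightarrow> nat \<Rightarrow> real" where
  "X i j = (b j - b i) / (a i - a j)"

definition F :: "nat \<Rightarrow> nat \<Rightarrow> real" where
  "F i j = c i * X i j + d i"

text \<open>The planes containing the \<open>h\<close>-th line form a pencil with parameter \<open>\<theta>\<close>; \<open>V h \<theta> i j\<close> is the
  height of such a plane over the crossing of the projections of the lines \<open>i\<close> and \<open>j\<close>, and
  \<open>S h i j\<close> is the parameter of the plane through the point of line \<open>i\<close> over that crossing.\<close>

definition G :: "nat \<Rightarrow> nat \<Rightarrow> nat \<Rightarrow> real" where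
  "G h i j = a h * X i j + b h - (a i * X i j + b i)"

definition V :: "nat \<Rightarrow> real \<Rightarrow> nat \<Rightarrow> nat \<Rightarrow> real" where
  "V h \<theta> i j = c h * X i j + d h + \<theta> * G h i j"

definition S :: "nat \<Rightarrow> nat \<Rightarrow> nat \<Rightarrow> real" where
  "S h i j = (F i j - (c h * X i j + d h)) / G h i j"

lemma X_commute: "X i j = X j i"
  unfolding X_def by (metis minus_diff_eq minus_divide_divide)

text \<open>Every plane through line \<open>i\<close> agrees with \<open>i\<close> along it; lines
  can therefore be compared with planes by lemmas about two planes.\<close>

lemma F_eq_V: "F i j = V i \<theta> i j"
  by (simp add: F_def V_def G_def)

text \<open>Over the projection of line \<open>i\<close> both planes have heights affine in the
  abscissa. Their difference, nonnegative at \<open>j\<close> and negative at \<open>k\<close>,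
  stays negative at \<open>l\<close> beyond \<open>k\<close>; the disjunction admits both directions
  of travel.\<close>

lemma V_extrapolate_less:
  assumes "X i j < X i k \<and> X i k < X i l \<or> X i l < X i k \<and> X i k < X i j"
    and "V h' \<theta>' i j \<le> V h \<theta> i j" "V h \<theta> i k < V h' \<theta>' i k"
  shows "V h \<theta> i l < V h' \<theta>' i l"
proof -
  define v where "v = c h + \<theta> * (a h - a i) - c h' - \<theta>' * (a h' - a i)"
  define u where "u = d h + \<theta> * (b h - b i) - d h' - \<theta>' * (b h' - b i)"
  have *: "V h \<theta> i m - V h' \<theta>' i m = u + v * X i m" for m
    by (simp add: V_def G_def u_def v_def algebra_simps)
  have "v * (X i k - X i j) < 0"
    using assms(2,3) *[of j] *[of k] by (simp add: algebra_simps)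
  moreover have "v * (X i l - X i k) < 0 \<longleftrightarrow> v * (X i k - X i j) < 0"
    using assms(1) by (auto simp: mult_less_0_iff)
  ultimately show ?thesis
    using assms(3) *[of l] *[of k] by (simp add: algebra_simps)
qed

lemma V_extrapolate_le:
  assumes "X i j < X i k \<and> X i k < X i l \<or> X i l < X i k \<and> X i k < X i j"
    and "V h' \<theta>' i j \<le> V h \<theta> i j" "V h \<theta> i k \<le> V h' \<theta>' i k"
  shows "V h \<theta> i l \<le> V h' \<theta>' i l"
proof -
  define v where "v = c h + \<theta> * (a h - a i) - c h' - \<theta>' * (a h' - a i)"
  define u where "u = d h + \<theta> * (b h - b i) - d h' - \<theta>' * (b h' - b i)"
  have *: "V h \<theta> i m - V h' \<theta>' i m = u + v * X i m" for m
    by (simp add: V_def G_def u_def v_def algebra_simps)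
  have "v * (X i k - X i j) \<le> 0"
    using assms(2,3) *[of j] *[of k] by (simp add: algebra_simps)
  moreover have "v * (X i l - X i k) \<le> 0 \<longleftrightarrow> v * (X i k - X i j) \<le> 0"
    using assms(1) by (auto simp: mult_le_0_iff)
  ultimately show ?thesis
    using assms(3) *[of l] *[of k] by (simp add: algebra_simps)
qed

end

text \<open>\<open>F_le\<close> ranges over all pairs because consecutive ones would not imply the
  others. Caps and opposite heights are brought to this form by reflecting the second and third
  coordinates and by reversing the sequence.\<close>

locale monotone_cup = line_family +
  fixes n :: nat
  assumes a_less: "\<lbrakk>i < j; j < n\<rbrakk> \<Longrightarrow> a i < a j"
    and cup: "\<lbrakk>i < j; j < k; k < n\<rbrakk> \<Longrightarrow> a i * X i k + b i < a j * X i k + b j"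
    and F_le: "\<lbrakk>i < j; j < n\<rbrakk> \<Longrightarrow> F i j \<le> F j i"
begin

lemma a_neq: "\<lbrakk>i \<noteq> j; i < n; j < n\<rbrakk> \<Longrightarrow> a i \<noteq> a j"
  using a_less[of i j] a_less[of j i] by (cases i j rule: linorder_cases) auto

lemma line_diff:
  assumes "i \<noteq> j" "i < n" "j < n"
  shows "a j * x + b j - (a i * x + b i) = (a j - a i) * (x - X i j)"
  using a_neq[OF assms] by (simp add: X_def field_simps)

lemma X_less1: "\<lbrakk>i < j; j < k; k < n\<rbrakk> \<Longrightarrow> X i j < X i k"
proof -
  assume h: "i < j" "j < k" "k < n"
  have "(a j - a i) * (X i k - X i j) > 0"
    using cup[OF h] line_diff[of i j "X i k"] h by simp
  then show ?thesis using a_less[of i j] h by (simp add: zero_less_mult_iff)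
qed

lemma X_less2: "\<lbrakk>i < j; j < k; k < n\<rbrakk> \<Longrightarrow> X i k < X j k"
proof -
  assume h: "i < j" "j < k" "k < n"
  have "a k * X i k + b k = a i * X i k + b i"
    using line_diff[of i k "X i k"] h by simp
  then have "(a k - a j) * (X i k - X j k) < 0"
    using cup[OF h] line_diff[of j k "X i k"] h by simp
  then show ?thesis using a_less[of j k] h by (simp add: mult_less_0_iff)
qed

lemma X_less3: "\<lbrakk>i < j; j < k; k < n\<rbrakk> \<Longrightarrow> X i j < X j k"
  using X_less1[of i j k] X_less2[of i j k] by simp

lemma G_commute: "\<lbrakk>i \<noteq> j; i < n; j < n\<rbrakk> \<Longrightarrow> G h i j = G h j i"
  using line_diff[of i j "X i j"] by (simp add: G_def X_commute)

lemma V_commute: "\<lbrakk>i \<noteq> j; i < n; j < n\<rbrakk> \<Longrightarrow> V h \<theta> i j = V h \<theta> j i"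
  by (simp add: V_def G_commute[of i j] X_commute[of i j])

lemma G_pos:
  assumes "i < h" "h < j" "j < n"
  shows "G h i j > 0" "G h j i > 0"
  using cup[OF assms] G_commute[of i j h] assms by (auto simp: G_def)

text \<open>For \<open>h\<close> between \<open>i\<close> and \<open>j\<close> the crossing of
  \<open>i\<close> and \<open>j\<close> projects below line \<open>h\<close>. So
  \<open>G h i j\<close> is positive, and the height of the plane over the crossing increases with
  \<theta>.\<close>

lemma V_S:
  assumes "i < h \<and> h < j \<and> j < n \<or> j < h \<and> h < i \<and> i < n"
  shows "V h (S h i j) i j = F i j" "\<theta> \<le> S h i j \<longleftrightarrow> V h \<theta> i j \<le> F i j"
    "S h i j \<le> \<theta> \<longleftrightarrow> F i j \<le> V h \<theta> i j"
proof -
  have "G h i j > 0" using assms G_pos by blast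
  then show "V h (S h i j) i j = F i j" "\<theta> \<le> S h i j \<longleftrightarrow> V h \<theta> i j \<le> F i j"
    "S h i j \<le> \<theta> \<longleftrightarrow> F i j \<le> V h \<theta> i j"
    by (auto simp: V_def S_def field_simps)
qed

text \<open>Where \<open>h\<close> crosses \<open>i\<close>, the plane with parameter
  \<open>S h i k\<close> has the height of \<open>h\<close>, hence is not below \<open>i\<close>.
  Were it below \<open>i\<close> at \<open>X i j\<close>, it would still be strictly below at
  \<open>X i k\<close>, where it meets \<open>i\<close> by definition.\<close>

lemma S_mono_right:
  assumes "i < h" "h < j" "j < k" "k < n"
  shows "S h i j \<le> S h i k"
proof (rule ccontr)
  assume "\<not> S h i j \<le> S h i k"
  then have "V h (S h i k) i j < V i 0 i j"
    using V_S(3)[of i h j "S h i k"] F_eq_V assms by auto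
  moreover have "V i 0 i h \<le> V h (S h i k) i h"
    using F_le[of i h] V_commute[of i h h] F_eq_V[of h i] F_eq_V[of i h] assms by auto
  ultimately have "V h (S h i k) i k < V i 0 i k"
    using assms X_less1[of i h j] X_less1[of i j k] by (intro V_extrapolate_less[of i h j k]) auto
  then show False using V_S(1)[of i h k] F_eq_V assms by auto
qed

text \<open>The same argument along line \<open>k\<close>, travelled to the left, with above and
  below exchanged.\<close>

lemma S_mono_left:
  assumes "i < j" "j < h" "h < k" "k < n"
  shows "S h k i \<le> S h k j"
proof (rule ccontr)
  assume "\<not> S h k i \<le> S h k j"
  then have "V k 0 k j < V h (S h k i) k j"
    using V_S(2)[of k h j "S h k i"] F_eq_V[of k j 0] assms by auto
  moreover have "V h (S h k i) k h \<le> V k 0 k h"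
    using F_le[of h k] V_commute[of k h h] F_eq_V[of h k] F_eq_V[of k h] assms by auto
  ultimately have "V k 0 k i < V h (S h k i) k i"
    using assms X_less2[of i j k] X_less2[of j h k]
    by (intro V_extrapolate_less[of k h j i]) (auto simp: X_commute)
  then show False using V_S(1)[of k h i] F_eq_V[of k i 0] assms by auto
qed

text \<open>The comparison left open by monotonicity: with outermost lines \<open>i\<close> and
  \<open>l\<close>, \<open>S h j l\<close> bounds the lower ends that belong to \<open>j\<close>
  from above, and \<open>S h k i\<close> bounds the upper ends that belong to \<open>k\<close> from
  below.\<close>

definition good :: "nat \<Rightarrow> nat \<Rightarrow> nat \<Rightarrow> nat \<Rightarrow> nat \<Rightarrow> bool" where
  "good i j h k l \<longleftrightarrow> S h j l \<le> S h k i"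

text \<open>If all three quintuples were bad, the heights over the crossing of the lines \<open>i1\<close> and \<open>i5\<close>
  would satisfy \<open>F i1 i5 > V i2 \<ge> V i3 > V i4 > F i5 i1\<close> for three planes through the lines
  \<open>i2\<close>, \<open>i3\<close> and \<open>i4\<close>, against \<open>F i1 i5 \<le> F i5 i1\<close>.\<close>

lemma exists_good:
  assumes lt: "i0 < i1" "i1 < i2" "i2 < i3" "i3 < i4" "i4 < i5" "i5 < i6" "i6 < n"
  shows "good i0 i1 i2 i3 i4 \<or> good i1 i2 i3 i4 i5 \<or> good i2 i3 i4 i5 i6"
proof (rule ccontr)
  assume "\<not> ?thesis"
  then have bad: "S i2 i3 i0 < S i2 i1 i4" "S i3 i4 i1 < S i3 i2 i5" "S i4 i5 i2 < S i4 i3 i6"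
    by (auto simp: good_def)
  \<comment> \<open>Each parameter is one side of a violated inequality: \<theta>2 an upper end,
    \<theta>3 and \<theta>4 lower ends. So the plane through \<open>i2\<close> passes strictly below
    \<open>i1\<close> over its crossing with \<open>i4\<close>, while those through
    \<open>i3\<close> and \<open>i4\<close> pass strictly above \<open>i4\<close> and
    \<open>i5\<close>.\<close>
  define \<theta>2 where "\<theta>2 = S i2 i3 i0"
  define \<theta>3 where "\<theta>3 = S i3 i2 i5"
  define \<theta>4 where "\<theta>4 = S i4 i3 i6"
  have two: "V i2 \<theta>2 i1 i4 < F i1 i4"
    using bad(1) V_S(3)[of i1 i2 i4 \<theta>2] lt by (auto simp: \<theta>2_def)
  have three: "F i4 i1 < V i3 \<theta>3 i4 i1"
    using bad(2) V_S(2)[of i4 i3 i1 \<theta>3] lt by (auto simp: \<theta>3_def)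
  have four: "F i5 i2 < V i4 \<theta>4 i5 i2"
    using bad(3) V_S(2)[of i5 i4 i2 \<theta>4] lt by (auto simp: \<theta>4_def)
  have on: "V h \<theta> i h = F h i" if "i \<noteq> h" "i < n" "h < n" for h \<theta> i
    using that V_commute[of i h] F_eq_V by metis
  have "V i2 \<theta>2 i3 i5 \<le> V i3 \<theta>3 i3 i5"
  proof (rule V_extrapolate_le[of _ i0 i2])
    show "X i3 i0 < X i3 i2 \<and> X i3 i2 < X i3 i5 \<or> X i3 i5 < X i3 i2 \<and> X i3 i2 < X i3 i0"
      using X_less2[of i0 i2 i3] X_less3[of i2 i3 i5] lt by (auto simp: X_commute)
    show "V i3 \<theta>3 i3 i0 \<le> V i2 \<theta>2 i3 i0"
      using V_S(1)[of i3 i2 i0] lt F_eq_V[of i3 i0 \<theta>3] by (auto simp: \<theta>2_def)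
    show "V i2 \<theta>2 i3 i2 \<le> V i3 \<theta>3 i3 i2"
      using on[of i3 i2 \<theta>2] lt F_le[of i2 i3] F_eq_V[of i3 i2 \<theta>3] by auto
  qed
  moreover have "V i2 \<theta>2 i5 i2 = V i3 \<theta>3 i5 i2"
    using on[of i5 i2 \<theta>2] V_S(1)[of i2 i3 i5] V_commute[of i2 i5 i3] lt by (auto simp: \<theta>3_def)
  \<comment> \<open>Along \<open>i5\<close>, the planes through \<open>i2\<close> and
    \<open>i3\<close> agree at the crossing with \<open>i2\<close>, by the choice of \<theta>3;
    beyond it their order at the crossing with \<open>i3\<close> is reversed.\<close>
  ultimately have a: "V i3 \<theta>3 i5 i1 \<le> V i2 \<theta>2 i5 i1"
    using X_less2[of i1 i2 i5] X_less2[of i2 i3 i5] V_commute[of i3 i5] lt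
    by (intro V_extrapolate_le[of i5 i3 i2 i1]) (auto simp: X_commute)
  have "V i2 \<theta>2 i1 i5 < V i1 0 i1 i5"
  proof (rule V_extrapolate_less[of _ i2 i4])
    show "X i1 i2 < X i1 i4 \<and> X i1 i4 < X i1 i5 \<or> X i1 i5 < X i1 i4 \<and> X i1 i4 < X i1 i2"
      using X_less1[of i1 i2 i4] X_less1[of i1 i4 i5] lt by auto
    show "V i1 0 i1 i2 \<le> V i2 \<theta>2 i1 i2"
      using on[of i1 i2 \<theta>2] F_le[of i1 i2] F_eq_V[of i1 i2 0] lt by auto
    show "V i2 \<theta>2 i1 i4 < V i1 0 i1 i4"
      using two F_eq_V[of i1 i4 0] by auto
  qed
  then have b: "V i2 \<theta>2 i5 i1 < F i1 i5"
    using V_commute[of i1 i5 i2] F_eq_V[of i1 i5 0] lt by auto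
  have "V i3 \<theta>3 i3 i1 \<le> V i4 \<theta>4 i3 i1"
  proof (rule V_extrapolate_le[of _ i6 i4])
    show "X i3 i6 < X i3 i4 \<and> X i3 i4 < X i3 i1 \<or> X i3 i1 < X i3 i4 \<and> X i3 i4 < X i3 i6"
      using X_less1[of i3 i4 i6] X_less3[of i1 i3 i4] lt by (auto simp: X_commute)
    show "V i4 \<theta>4 i3 i6 \<le> V i3 \<theta>3 i3 i6"
      using V_S(1)[of i3 i4 i6] lt F_eq_V[of i3 i6 \<theta>3] by (auto simp: \<theta>4_def)
    show "V i3 \<theta>3 i3 i4 \<le> V i4 \<theta>4 i3 i4"
      using on[of i3 i4 \<theta>4] lt F_le[of i3 i4] F_eq_V[of i3 i4 \<theta>3] by auto
  qed
  then have "V i3 \<theta>3 i1 i3 \<le> V i4 \<theta>4 i1 i3"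
    using V_commute[of i1 i3] lt by auto
  moreover have "V i4 \<theta>4 i1 i4 < V i3 \<theta>3 i1 i4"
    using three on[of i1 i4 \<theta>4] V_commute[of i1 i4 i3] lt by auto
  ultimately have "V i4 \<theta>4 i1 i5 < V i3 \<theta>3 i1 i5"
    using X_less1[of i1 i3 i4] X_less1[of i1 i4 i5] lt by (intro V_extrapolate_less[of i1 i3 i4 i5]) auto
  then have c: "V i4 \<theta>4 i5 i1 < V i3 \<theta>3 i5 i1"
    using V_commute[of i1 i5] lt by auto
  have "V i5 0 i5 i1 < V i4 \<theta>4 i5 i1"
  proof (rule V_extrapolate_less[of _ i4 i2])
    show "X i5 i4 < X i5 i2 \<and> X i5 i2 < X i5 i1 \<or> X i5 i1 < X i5 i2 \<and> X i5 i2 < X i5 i4"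
      using X_less2[of i1 i2 i5] X_less2[of i2 i4 i5] lt by (auto simp: X_commute)
    show "V i4 \<theta>4 i5 i4 \<le> V i5 0 i5 i4"
      using on[of i5 i4 \<theta>4] F_le[of i4 i5] F_eq_V[of i5 i4 0] lt by auto
    show "V i5 0 i5 i2 < V i4 \<theta>4 i5 i2"
      using four F_eq_V[of i5 i2 0] by auto
  qed
  then show False
    using a b c F_le[of i1 i5] F_eq_V[of i5 i1 0] lt by auto
qed


end

lemma ex_separating_plane:
  fixes q r :: nat
  assumes r: "1 \<le> r" "r < q"
  shows "\<exists>N. \<forall>a b c d. monotone_cup a b c d N \<longrightarrow>
    (\<exists>e \<alpha> \<beta> \<gamma>. strict_mono_on {1..q} e \<and> (\<forall>i\<in>{1..q}. e i < N) \<and>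
      (\<forall>i\<in>{1..r}. \<forall>j\<in>{r<..q}. \<forall>x. x = line_family.X a b (e i) (e j) \<longrightarrow>
         c (e i) * x + d (e i) \<le> \<alpha> + \<beta> * x + \<gamma> * (a (e i) * x + b (e i)) \<and>
         \<alpha> + \<beta> * x + \<gamma> * (a (e i) * x + b (e i)) \<le> c (e j) * x + d (e j)))"
proof -
  \<comment> \<open>\<open>q+7\<close> provides the seven lines of \<open>exists_good\<close> and
    the \<open>q+3\<close> indices used below: \<open>0\<close> and \<open>q+2\<close> as outermost
    lines, \<open>r+1\<close> for \<open>h\<close>, and \<open>q\<close> lines around it.\<close>
  from ramsey_quintuples[of "q+7"]
  obtain N where N: "\<forall>P :: nat \<Rightarrow> nat \<Rightarrow> nat \<Rightarrow> nat \<Rightarrow> nat \<Rightarrow> bool.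
     \<exists>e c. strict_mono_on {..<q+7} e \<and> (\<forall>i<q+7. e i < N) \<and>
     (\<forall>i j k l n. i < j \<and> j < k \<and> k < l \<and> l < n \<and> n < q+7 \<longrightarrow> P (e i) (e j) (e k) (e l) (e n) = c)"
    by (rule exE)
  show ?thesis
  proof (intro exI[of _ N] allI impI)
    fix a b c d
    assume "monotone_cup a b c d N"
    then interpret monotone_cup a b c d N .
    obtain e v where e1: "strict_mono_on {..<q+7} e" and e2: "\<forall>i<q+7. e i < N" and
      v: "\<forall>i j k l n. i < j \<and> j < k \<and> k < l \<and> l < n \<and> n < q+7 \<longrightarrow> good (e i) (e j) (e k) (e l) (e n) = v"
      using spec[OF N, of good] by (elim exE conjE) (rule that)
    note e = e1 e2[rule_format]
    have lt: "e i < e j" if "i < j" "j < q+7" for i j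
      using e(1) that by (simp add: strict_mono_on_def)
    have good: "good (e i) (e j) (e k) (e l) (e n)" if "i < j" "j < k" "k < l" "l < n" "n < q+7" for i j k l n
    proof -
      have "good (e 0) (e 1) (e 2) (e 3) (e 4) \<or> good (e 1) (e 2) (e 3) (e 4) (e 5) \<or> good (e 2) (e 3) (e 4) (e 5) (e 6)"
        by (rule exists_good) (auto intro: lt e)
      then have v
        using v[rule_format, of 0 1 2 3 4] v[rule_format, of 1 2 3 4 5] v[rule_format, of 2 3 4 5 6] by auto
      then show ?thesis using v[rule_format, of i j k l n] that by simp
    qed
    define h where "h = e (r+1)"
    define L where "L = (\<lambda>(i, j). S h (e i) (e j)) ` ({1..r} \<times> {r+2..q+1})"
    \<comment> \<open>The largest lower end; by \<open>key\<close> it is at most every upper end, so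
      it lies in all the intervals.\<close>
    define \<theta> where "\<theta> = Max L"
    have fin: "finite L" "L \<noteq> {}" using r by (auto simp: L_def)
    have key: "S h (e i') (e j') \<le> S h (e j) (e i)"
      if "i \<in> {1..r}" "i' \<in> {1..r}" "j \<in> {r+2..q+1}" "j' \<in> {r+2..q+1}" for i j i' j'
    proof -
      have "S h (e i') (e j') \<le> S h (e i') (e (q+2))"
        unfolding h_def by (rule S_mono_right) (use that r in \<open>auto intro: lt e\<close>)
      also have "\<dots> \<le> S h (e j) (e 0)"
        using good[of 0 i' "r+1" j "q+2"] that r by (auto simp: good_def h_def)
      also have "\<dots> \<le> S h (e j) (e i)"
        unfolding h_def by (rule S_mono_left) (use that r in \<open>auto intro: lt e\<close>)
      finally show ?thesis .
    qed
    \<comment> \<open>Index \<open>r+1\<close> is skipped: line \<open>h\<close> only carries the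
      plane and is not among the \<open>q\<close> lines returned.\<close>
    define f where "f = (\<lambda>i. if i \<le> r then e i else e (i+1))"
    have f12: "strict_mono_on {1..q} f" "\<forall>i\<in>{1..q}. f i < N"
      using r by (auto simp: strict_mono_on_def f_def intro: lt e)
    have f3: "c (f i) * x + d (f i) \<le> (d h + \<theta> * b h) + (c h + \<theta> * a h) * x + - \<theta> * (a (f i) * x + b (f i)) \<and>
         (d h + \<theta> * b h) + (c h + \<theta> * a h) * x + - \<theta> * (a (f i) * x + b (f i)) \<le> c (f j) * x + d (f j)"
      if i: "i \<in> {1..r}" and j: "j \<in> {r<..q}" and x: "x = X (f i) (f j)" for i j x
    proof -
      have f: "f i = e i" "f j = e (j+1)" using i j by (auto simp: f_def)
      have V: "(d h + \<theta> * b h) + (c h + \<theta> * a h) * x + - \<theta> * (a (f i) * x + b (f i)) = V h \<theta> (f i) (f j)"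
        by (simp add: V_def G_def x algebra_simps)
      have j': "j+1 \<in> {r+2..q+1}" using j by auto
      have lts: "f i < h" "h < f j" "f j < N" using i j r by (auto simp: f h_def intro: lt e)
      have "S h (f i) (f j) \<le> \<theta>"
        unfolding \<theta>_def f using fin i j' by (intro Max_ge) (auto simp: L_def)
      moreover have "\<theta> \<le> S h (f j) (f i)"
        using fin key[OF i _ j'] unfolding \<theta>_def f by (subst Max_le_iff) (auto simp: L_def)
      ultimately show ?thesis
        using V_S(3)[of "f i" h "f j" \<theta>] V_S(2)[of "f j" h "f i" \<theta>] V_commute[of "f i" "f j" h \<theta>] lts
        unfolding V by (auto simp: F_def x X_commute)
    qed
    show "\<exists>e \<alpha> \<beta> \<gamma>. strict_mono_on {1..q} e \<and> (\<forall>i\<in>{1..q}. e i < N) \<and>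
      (\<forall>i\<in>{1..r}. \<forall>j\<in>{r<..q}. \<forall>x. x = X (e i) (e j) \<longrightarrow>
         c (e i) * x + d (e i) \<le> \<alpha> + \<beta> * x + \<gamma> * (a (e i) * x + b (e i)) \<and>
         \<alpha> + \<beta> * x + \<gamma> * (a (e i) * x + b (e i)) \<le> c (e j) * x + d (e j))"
      by (intro exI[of _ f] exI[of _ "d h + \<theta> * b h"] exI[of _ "c h + \<theta> * a h"] exI[of _ "- \<theta>"]
          conjI f12 ballI allI impI conjunct1[OF f3] conjunct2[OF f3])
  qed
qed

section \<open>Pairwise crossing segments in planar convex sets\<close>

text \<open>The gap in \<open>Y\<close> between points of equal parameter is affine in the parameter
  and passes from one weak sign to the other; \<open>s\<close> is its zero. Abstract coordinates
  \<open>X\<close>, \<open>Y\<close> also cover reflected pictures.\<close>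

lemma closed_segments_cross:
  fixes X Y :: "real^2 \<Rightarrow> real"
  assumes "linear X" "linear Y" and inj: "\<And>u v. X u = X v \<Longrightarrow> Y u = Y v \<Longrightarrow> u = v"
    and "X p = X p'" "X q = X q'" "Y p \<le> Y p'" "Y q' \<le> Y q"
  shows "closed_segment p q \<inter> closed_segment p' q' \<noteq> {}"
proof (cases "Y p' - Y p + (Y q - Y q') = 0")
  case True
  then have "p = p'" using assms by (intro inj) auto
  then show ?thesis by auto
next
  case False
  define s where "s = (Y p' - Y p) / (Y p' - Y p + (Y q - Y q'))"
  have s: "0 \<le> s" "s \<le> 1" using assms False by (auto simp: s_def field_simps)
  have "s * (Y p' - Y p + (Y q - Y q')) = Y p' - Y p" using False by (simp add: s_def)
  then have "(1 - s) *\<^sub>R p + s *\<^sub>R q = (1 - s) *\<^sub>R p' + s *\<^sub>R q'"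
    using assms(1,2,4,5) by (intro inj) (auto simp: linear_add linear_diff linear_scale algebra_simps)
  moreover have "(1 - s) *\<^sub>R p + s *\<^sub>R q \<in> closed_segment p q" "(1 - s) *\<^sub>R p' + s *\<^sub>R q' \<in> closed_segment p' q'"
    using s by (auto simp: in_segment)
  ultimately show ?thesis by auto
qed

lemma closed_segment_slice:
  assumes "linear X" "X p \<le> c \<and> c \<le> X q \<or> X q \<le> c \<and> c \<le> X p"
  obtains t where "t \<in> closed_segment p q" "X t = (c::real)"
proof -
  have "c \<in> closed_segment (X p) (X q)"
    using assms(2) by (auto simp: closed_segment_eq_real_ivl)
  then show ?thesis
    using that closed_segment_linear_image[OF assms(1), of p q] by auto
qed

text \<open>The slice of \<open>A\<close> through the abscissa of \<open>x\<close> is convex and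
  misses \<open>x\<close>, so it lies on one side of it.\<close>

lemma convex_slice_side:
  fixes X Y :: "real^2 \<Rightarrow> real"
  assumes "linear X" "linear Y" and inj: "\<And>u v. X u = X v \<Longrightarrow> Y u = Y v \<Longrightarrow> u = v"
    and "convex A" "x \<notin> A"
    and "\<not> (\<forall>t\<in>A. X t = X x \<longrightarrow> Y t < Y x)" "t \<in> A" "X t = X x"
  shows "Y x < Y t"
proof (rule ccontr)
  assume "\<not> Y x < Y t"
  obtain u where u: "u \<in> A" "X u = X x" "Y x \<le> Y u" using assms(6) by force
  have "closed_segment x x \<inter> closed_segment u t \<noteq> {}"
    using \<open>\<not> Y x < Y t\<close> u assms by (intro closed_segments_cross[of X Y]) auto
  then show False
    using closed_segment_subset[OF u(1) assms(7) assms(4)] assms(5) by auto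
qed

text \<open>All sets meet the line \<open>X = c\<close>, the set \<open>A i\<close> extends to the right as far as \<open>X = \<rho> i\<close>, and every
  later set meets \<open>X = \<rho> i\<close> too. Once the relevant order patterns are homogeneous, each set gets a
  segment between two of three transversals: the line \<open>X = c\<close>, the line \<open>X = \<rho> 0\<close>, and the first
  or the last set of the family.\<close>

lemma homogeneous_crossing_segments:
  fixes X Y :: "real^2 \<Rightarrow> real" and A :: "nat \<Rightarrow> (real^2) set"
  assumes lin: "linear X" "linear Y" and inj: "\<And>u v. X u = X v \<Longrightarrow> Y u = Y v \<Longrightarrow> u = v"
    and conv: "\<And>i. i < m \<Longrightarrow> convex (A i)"
    and disj: "\<And>i j k. \<lbrakk>i < j; j < k; k < m\<rbrakk> \<Longrightarrow> A i \<inter> A j \<inter> A k = {}"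
    and xA: "\<And>i j. \<lbrakk>i < j; j < m\<rbrakk> \<Longrightarrow> x i j \<in> A i \<inter> A j"
    and xX: "\<And>i j. \<lbrakk>i < j; j < m\<rbrakk> \<Longrightarrow> c \<le> X (x i j) \<and> X (x i j) \<le> \<rho> i"
    and y: "\<And>i. i < m \<Longrightarrow> y i \<in> A i \<and> X (y i) = c"
    and z: "\<And>i j. \<lbrakk>i < j; j < m\<rbrakk> \<Longrightarrow> z i j \<in> A j \<and> X (z i j) = \<rho> i"
    and Yy: "\<And>i j. \<lbrakk>i < j; j < m\<rbrakk> \<Longrightarrow> Y (y i) \<le> Y (y j)"
    and B1: "\<And>i j k. \<lbrakk>i < j; j < k; k < m\<rbrakk> \<Longrightarrow> Y (z i j) \<le> Y (z i k) \<longleftrightarrow> B1"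
    and B2: "\<And>i j k. \<lbrakk>i < j; j < k; k < m\<rbrakk> \<Longrightarrow> X (x i j) \<le> X (x i k) \<longleftrightarrow> B2"
    and B3: "\<And>i j k. \<lbrakk>i < j; j < k; k < m\<rbrakk> \<Longrightarrow> (\<forall>t\<in>A j. X t = X (x i k) \<longrightarrow> Y t < Y (x i k)) \<longleftrightarrow> B3"
    and B4: "\<And>i j k. \<lbrakk>i < j; j < k; k < m\<rbrakk> \<Longrightarrow> X (x i k) \<le> X (x j k) \<longleftrightarrow> B4"
  shows "\<exists>p q. (\<forall>j. 0 < j \<and> Suc j < m \<longrightarrow> p j \<in> A j \<and> q j \<in> A j) \<and>
    (\<forall>i j. 0 < i \<and> i < j \<and> Suc j < m \<longrightarrow> closed_segment (p i) (q i) \<inter> closed_segment (p j) (q j) \<noteq> {})"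
proof -
  note cross = closed_segments_cross[OF lin inj]
  let ?P = "\<lambda>p q. (\<forall>j. 0 < j \<and> Suc j < m \<longrightarrow> p j \<in> A j \<and> q j \<in> A j) \<and>
    (\<forall>i j. 0 < i \<and> i < j \<and> Suc j < m \<longrightarrow> closed_segment (p i) (q i) \<inter> closed_segment (p j) (q j) \<noteq> {})"
  have I: "\<exists>p q. ?P p q"
    if "\<And>j. \<lbrakk>0 < j; Suc j < m\<rbrakk> \<Longrightarrow> p j \<in> A j \<and> q j \<in> A j"
      "\<And>i j. \<lbrakk>0 < i; i < j; Suc j < m\<rbrakk> \<Longrightarrow> closed_segment (p i) (q i) \<inter> closed_segment (p j) (q j) \<noteq> {}" for p q
    using that by blast
  have seg: "t \<in> A j" "closed_segment t v \<subseteq> closed_segment u v" "closed_segment u t \<subseteq> closed_segment u v"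
    if "t \<in> closed_segment u v" "u \<in> A j" "v \<in> A j" "j < m" for t u v j
    using that conv[of j] closed_segment_subset[of u "A j" v] subset_closed_segment[of t v u v] subset_closed_segment[of u t u v]
    by auto
  have above: "Y t < Y (x i k)" if "B3" "i < j" "j < k" "k < m" "t \<in> A j" "X t = X (x i k)" for i j k t
    using B3[of i j k] that by auto
  have below: "Y (x i k) < Y t" if "\<not> B3" "i < j" "j < k" "k < m" "t \<in> A j" "X t = X (x i k)" for i j k t
  proof (rule convex_slice_side[OF lin inj])
    show "convex (A j)" using conv that by auto
    show "x i k \<notin> A j" using disj[of i j k] xA[of i k] that by auto
    show "\<not> (\<forall>t\<in>A j. X t = X (x i k) \<longrightarrow> Y t < Y (x i k))" using B3 that by auto
  qed (use that in auto)
  \<comment> \<open>The last index. The sets \<open>0\<close> and \<open>M\<close> may serve as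
    transversals and receive no segment.\<close>
  define M where "M = m - 1"
  consider "\<not> B1" | "B1" "\<not> B3" "B2" | "B1" "\<not> B3" "\<not> B2" | "B1" "B3" "B4" | "B1" "B3" "\<not> B4" by blast
  then show ?thesis
  proof cases
    \<comment> \<open>Heights on X = c increase weakly with the index, those on X = \<rho> 0
      decrease; the segments between these two lines cross.\<close>
    case 1
    show ?thesis
    proof (rule I[of y "z 0"])
      fix i j assume "0 < i" "i < j" "Suc j < m"
      then show "closed_segment (y i) (z 0 i) \<inter> closed_segment (y j) (z 0 j) \<noteq> {}"
        using y[of i] y[of j] z[of 0 i] z[of 0 j] Yy[of i j] B1[of 0 i j] 1 by (intro cross) auto
    qed (use y z in auto)
  next
    \<comment> \<open>The point \<open>x 0 j\<close> lies below \<open>A i\<close> and not to the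
      left of \<open>x 0 i\<close>. At its abscissa the segment of \<open>i\<close> is above that of
      \<open>j\<close>, and on X = \<rho> 0 it is not.\<close>
    case 2
    show ?thesis
    proof (rule I[of "x 0" "z 0"])
      fix i j assume h: "0 < i" "i < j" "Suc j < m"
      obtain t where t: "t \<in> closed_segment (x 0 i) (z 0 i)" "X t = X (x 0 j)"
        using closed_segment_slice[OF lin(1), of "x 0 i" "X (x 0 j)" "z 0 i"] B2[of 0 i j] 2 h z[of 0 i] xX[of 0 j] by auto
      note s = seg[of t "x 0 i" "z 0 i" i]
      have "closed_segment (x 0 j) (z 0 j) \<inter> closed_segment t (z 0 i) \<noteq> {}"
        using t h z[of 0 i] z[of 0 j] xA[of 0 i] B1[of 0 i j] 2 below[of 0 i j t] s by (intro cross) auto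
      then show "closed_segment (x 0 i) (z 0 i) \<inter> closed_segment (x 0 j) (z 0 j) \<noteq> {}"
        using s t h z[of 0 i] xA[of 0 i] by auto
    qed (use xA z in auto)
  next
    case 3
    show ?thesis
    proof (rule I[of y "x 0"])
      fix i j assume h: "0 < i" "i < j" "Suc j < m"
      obtain t where t: "t \<in> closed_segment (y i) (x 0 i)" "X t = X (x 0 j)"
        using closed_segment_slice[OF lin(1), of "y i" "X (x 0 j)" "x 0 i"] B2[of 0 i j] 3 h y[of i] xX[of 0 j] by auto
      note s = seg[of t "y i" "x 0 i" i]
      have "closed_segment (y i) t \<inter> closed_segment (y j) (x 0 j) \<noteq> {}"
        using t h y[of i] y[of j] xA[of 0 i] Yy[of i j] 3 below[of 0 i j t] s by (intro cross) auto
      then show "closed_segment (y i) (x 0 i) \<inter> closed_segment (y j) (x 0 j) \<noteq> {}"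
        using s t h y[of i] xA[of 0 i] by auto
    qed (use xA y in auto)
  next
    \<comment> \<open>Now \<open>x i M\<close> lies above \<open>A j\<close>, so the last set takes
      the part that the first set has when \<open>B3\<close> fails.\<close>
    case 4
    show ?thesis
    proof (rule I[of y "\<lambda>j. x j M"])
      fix i j assume h: "0 < i" "i < j" "Suc j < m"
      then have M: "j < M" "M < m" by (auto simp: M_def)
      obtain t where t: "t \<in> closed_segment (y j) (x j M)" "X t = X (x i M)"
        using closed_segment_slice[OF lin(1), of "y j" "X (x i M)" "x j M"] B4[of i j M] 4 h M y[of j] xX[of i M] by auto
      note s = seg[of t "y j" "x j M" j]
      have "closed_segment (y i) (x i M) \<inter> closed_segment (y j) t \<noteq> {}"
        using t h M y[of i] y[of j] xA[of j M] Yy[of i j] 4 above[of i j M t] s by (intro cross) auto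
      then show "closed_segment (y i) (x i M) \<inter> closed_segment (y j) (x j M) \<noteq> {}"
        using s t h M y[of j] xA[of j M] by auto
    qed (use xA y in \<open>auto simp: M_def\<close>)
  next
    case 5
    show ?thesis
    proof (rule I[of "\<lambda>j. x j M" "z 0"])
      fix i j assume h: "0 < i" "i < j" "Suc j < m"
      then have M: "j < M" "M < m" by (auto simp: M_def)
      \<comment> \<open>\<open>\<not> B4\<close> places \<open>x i M\<close> to the left of
        \<open>x 0 M\<close>, which is within the reach \<rho> 0 of the first set.\<close>
      have "X (x i M) \<le> \<rho> 0" using B4[of 0 i M] xX[of 0 M] 5 h M by auto
      then obtain t where t: "t \<in> closed_segment (x j M) (z 0 j)" "X t = X (x i M)"
        using closed_segment_slice[OF lin(1), of "x j M" "X (x i M)" "z 0 j"] B4[of i j M] 5 h M z[of 0 j] by auto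
      note s = seg[of t "x j M" "z 0 j" j]
      have "closed_segment t (z 0 j) \<inter> closed_segment (x i M) (z 0 i) \<noteq> {}"
        using t h M z[of 0 i] z[of 0 j] xA[of j M] B1[of 0 i j] 5 above[of i j M t] s by (intro cross) auto
      then show "closed_segment (x i M) (z 0 i) \<inter> closed_segment (x j M) (z 0 j) \<noteq> {}"
        using s t h M z[of 0 j] xA[of j M] by auto
    qed (use xA z in \<open>auto simp: M_def\<close>)
  qed
qed

text \<open>Whether heights on X = c increase is known only after Ramsey's theorem has been applied,
  so the colour records the patterns for \<open>Y\<close> and for its negative, and the fitting half
  is kept. Of \<open>m+3\<close> indices one completes pairs to triples, and the outer two of the
  rest are the transversal sets.\<close>

lemma sorted_chain_crossing_segments:
  fixes A :: "nat \<Rightarrow> (real^2) set" and X :: "real^2 \<Rightarrow> real" and x z :: "nat \<Rightarrow> nat \<Rightarrow> real^2" and m N :: nat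
  assumes ramsey: "\<forall>f :: nat \<Rightarrow> nat \<Rightarrow> nat \<Rightarrow> bool \<times> (bool \<times> bool \<times> bool \<times> bool) \<times> (bool \<times> bool \<times> bool \<times> bool).
      \<exists>e v. strict_mono_on {..<m+3} e \<and> (\<forall>i<m+3. e i < N) \<and>
     (\<forall>i j k. i < j \<and> j < k \<and> k < m+3 \<longrightarrow> f (e i) (e j) (e k) = v)"
    and lin: "linear X" and inj: "\<And>u v. X u = X v \<Longrightarrow> u $ 2 = v $ 2 \<Longrightarrow> u = v"
    and conv: "\<And>i. i < N \<Longrightarrow> convex (A i)"
    and disj: "\<And>i j k. \<lbrakk>i < j; j < k; k < N\<rbrakk> \<Longrightarrow> A i \<inter> A j \<inter> A k = {}"
    and xA: "\<And>i j. \<lbrakk>i < j; j < N\<rbrakk> \<Longrightarrow> x i j \<in> A i \<inter> A j"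
    and xX: "\<And>i j. \<lbrakk>i < j; j < N\<rbrakk> \<Longrightarrow> c \<le> X (x i j) \<and> X (x i j) \<le> \<rho> i"
    and y: "\<And>i. i < N \<Longrightarrow> y i \<in> A i \<and> X (y i) = c"
    and z: "\<And>i j. \<lbrakk>i < j; j < N\<rbrakk> \<Longrightarrow> z i j \<in> A j \<and> X (z i j) = \<rho> i"
  shows "\<exists>e p q. strict_mono_on {..<m} e \<and> (\<forall>i<m. e i < N \<and> p i \<in> A (e i) \<and> q i \<in> A (e i)) \<and>
    (\<forall>i j. i < j \<and> j < m \<longrightarrow> closed_segment (p i) (q i) \<inter> closed_segment (p j) (q j) \<noteq> {})"
proof -
  define g :: "(real^2 \<Rightarrow> real) \<Rightarrow> nat \<Rightarrow> nat \<Rightarrow> nat \<Rightarrow> bool \<times> bool \<times> bool \<times> bool" where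
    "g = (\<lambda>Y i j k. (Y (z i j) \<le> Y (z i k), X (x i j) \<le> X (x i k),
       (\<forall>t\<in>A j. X t = X (x i k) \<longrightarrow> Y t < Y (x i k)), X (x i k) \<le> X (x j k)))"
  define Yp :: "real^2 \<Rightarrow> real" where "Yp = (\<lambda>u. u $ 2)"
  define Yn :: "real^2 \<Rightarrow> real" where "Yn = (\<lambda>u. - u $ 2)"
  from ramsey[rule_format, of "\<lambda>i j k. (y i $ 2 \<le> y j $ 2, g Yp i j k, g Yn i j k)"]
  obtain e v where e: "strict_mono_on {..<m+3} e" and eN: "\<forall>i<m+3. e i < N" and
    v: "\<forall>i j k. i < j \<and> j < k \<and> k < m+3 \<longrightarrow>
      (y (e i) $ 2 \<le> y (e j) $ 2, g Yp (e i) (e j) (e k), g Yn (e i) (e j) (e k)) = v"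
    by (elim exE conjE) (rule that)
  have lt: "e i < e j" if "i < j" "j < m+3" for i j
    using e that by (simp add: strict_mono_on_def)
  obtain Y w where Y: "linear Y" "\<And>u v. X u = X v \<Longrightarrow> Y u = Y v \<Longrightarrow> u = v" and
    Yy: "\<And>i j. \<lbrakk>i < j; j < m+2\<rbrakk> \<Longrightarrow> Y (y (e i)) \<le> Y (y (e j))" and
    w: "\<And>i j k. \<lbrakk>i < j; j < k; k < m+2\<rbrakk> \<Longrightarrow> g Y (e i) (e j) (e k) = w"
  proof (cases "fst v")
    case True
    show ?thesis
    proof (rule that[of Yp "fst (snd v)"])
      show "linear Yp" by (auto simp: Yp_def intro!: linearI)
      show "Yp (y (e i)) \<le> Yp (y (e j))" if "i < j" "j < m+2" for i j
        using v[rule_format, of i j "m+2"] that True by (auto simp: Yp_def)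
      show "g Yp (e i) (e j) (e k) = fst (snd v)" if "i < j" "j < k" "k < m+2" for i j k
        using v[rule_format, of i j k] that by auto
    qed (use inj in \<open>auto simp: Yp_def\<close>)
  next
    case False
    show ?thesis
    proof (rule that[of Yn "snd (snd v)"])
      show "linear Yn" by (auto simp: Yn_def intro!: linearI)
      show "Yn (y (e i)) \<le> Yn (y (e j))" if "i < j" "j < m+2" for i j
        using v[rule_format, of i j "m+2"] that False by (auto simp: Yn_def)
      show "g Yn (e i) (e j) (e k) = snd (snd v)" if "i < j" "j < k" "k < m+2" for i j k
        using v[rule_format, of i j k] that by auto
    qed (use inj in \<open>auto simp: Yn_def\<close>)
  qed
  obtain B1 B2 B3 B4 where B: "w = (B1, B2, B3, B4)" by (cases w)
  have "\<exists>p q. (\<forall>j. 0 < j \<and> Suc j < m+2 \<longrightarrow> p j \<in> A (e j) \<and> q j \<in> A (e j)) \<and>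
    (\<forall>i j. 0 < i \<and> i < j \<and> Suc j < m+2 \<longrightarrow> closed_segment (p i) (q i) \<inter> closed_segment (p j) (q j) \<noteq> {})"
  proof (rule homogeneous_crossing_segments[OF lin Y, where x = "\<lambda>i j. x (e i) (e j)" and z = "\<lambda>i j. z (e i) (e j)"
        and y = "\<lambda>i. y (e i)" and c = c and \<rho> = "\<lambda>i. \<rho> (e i)" and ?B1.0 = B1 and ?B2.0 = B2 and ?B3.0 = B3 and ?B4.0 = B4])
    fix i j k assume "i < j" "j < k" "k < m+2"
    from w[OF this] show "Y (z (e i) (e j)) \<le> Y (z (e i) (e k)) \<longleftrightarrow> B1"
      "X (x (e i) (e j)) \<le> X (x (e i) (e k)) \<longleftrightarrow> B2"
      "(\<forall>t\<in>A (e j). X t = X (x (e i) (e k)) \<longrightarrow> Y t < Y (x (e i) (e k))) \<longleftrightarrow> B3"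
      "X (x (e i) (e k)) \<le> X (x (e j) (e k)) \<longleftrightarrow> B4"
      by (auto simp: g_def B)
  next
    fix i j assume ij: "i < j" "j < m+2"
    then have *: "e i < e j" "e j < N" using lt eN by auto
    show "x (e i) (e j) \<in> A (e i) \<inter> A (e j)" by (rule xA[OF *])
    show "c \<le> X (x (e i) (e j)) \<and> X (x (e i) (e j)) \<le> \<rho> (e i)" by (rule xX[OF *])
    show "z (e i) (e j) \<in> A (e j) \<and> X (z (e i) (e j)) = \<rho> (e i)" by (rule z[OF *])
    show "Y (y (e i)) \<le> Y (y (e j))" by (rule Yy[OF ij])
  next
    fix i assume "i < m+2"
    then have "e i < N" using eN by auto
    then show "convex (A (e i))" "y (e i) \<in> A (e i) \<and> X (y (e i)) = c" using conv y by auto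
  next
    fix i j k assume "i < j" "j < k" "k < m+2"
    then show "A (e i) \<inter> A (e j) \<inter> A (e k) = {}" using lt eN by (intro disj) auto
  qed
  then obtain p q where pq: "\<forall>j. 0 < j \<and> Suc j < m+2 \<longrightarrow> p j \<in> A (e j) \<and> q j \<in> A (e j)"
    "\<forall>i j. 0 < i \<and> i < j \<and> Suc j < m+2 \<longrightarrow> closed_segment (p i) (q i) \<inter> closed_segment (p j) (q j) \<noteq> {}"
    by (elim exE conjE) (rule that)
  have "strict_mono_on {..<m} (\<lambda>i. e (Suc i))" using lt by (auto simp: strict_mono_on_def)
  with pq eN show ?thesis
    by (intro exI[of _ "\<lambda>i. e (Suc i)"] exI[of _ "\<lambda>i. p (Suc i)"] exI[of _ "\<lambda>i. q (Suc i)"]) auto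
qed

lemma ex_sorting_bij:
  fixes f :: "nat \<Rightarrow> real"
  obtains \<pi> where "bij_betw \<pi> {..<n} {..<n}" "\<And>i j. \<lbrakk>i < j; j < n\<rbrakk> \<Longrightarrow> f (\<pi> i) \<le> f (\<pi> j)"
proof -
  define xs where "xs = sort_key f [0..<n]"
  have "bij_betw ((!) xs) {..<length xs} (set xs)"
    by (rule bij_betw_nth) (auto simp: xs_def)
  moreover have "sorted (map f xs)" "length xs = n" "set xs = {..<n}" by (auto simp: xs_def)
  ultimately show ?thesis
    using that[of "(!) xs"] by (auto simp: sorted_iff_nth_mono)
qed

lemma ex_pairwise_crossing_segments:
  fixes m :: nat
  shows "\<exists>N. \<forall>A :: nat \<Rightarrow> (real^2) set.
     (\<forall>i<N. convex (A i)) \<longrightarrow> (\<forall>i<N. \<forall>j<N. A i \<inter> A j \<noteq> {}) \<longrightarrow>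
     (\<forall>i<N. \<forall>j<N. \<forall>k<N. i \<noteq> j \<and> j \<noteq> k \<and> i \<noteq> k \<longrightarrow> A i \<inter> A j \<inter> A k = {}) \<longrightarrow>
     (\<exists>e p q. inj_on e {..<m} \<and> (\<forall>i<m. e i < N \<and> p i \<in> A (e i) \<and> q i \<in> A (e i)) \<and>
       (\<forall>i j. i < j \<and> j < m \<longrightarrow> closed_segment (p i) (q i) \<inter> closed_segment (p j) (q j) \<noteq> {}))"
proof -
  from ramsey_triples[of "m+3", where ?'c = "bool \<times> (bool \<times> bool \<times> bool \<times> bool) \<times> (bool \<times> bool \<times> bool \<times> bool)"]
  obtain N1 where N1: "\<forall>f :: nat \<Rightarrow> nat \<Rightarrow> nat \<Rightarrow> bool \<times> (bool \<times> bool \<times> bool \<times> bool) \<times> (bool \<times> bool \<times> bool \<times> bool).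
      \<exists>e v. strict_mono_on {..<m+3} e \<and> (\<forall>i<m+3. e i < N1) \<and>
     (\<forall>i j k. i < j \<and> j < k \<and> k < m+3 \<longrightarrow> f (e i) (e j) (e k) = v)"
    by (rule exE)
  from ramsey_triples[of "Suc N1", where ?'c = bool]
  obtain N where N: "\<forall>f :: nat \<Rightarrow> nat \<Rightarrow> nat \<Rightarrow> bool.
      \<exists>e v. strict_mono_on {..<Suc N1} e \<and> (\<forall>i<Suc N1. e i < N) \<and>
     (\<forall>i j k. i < j \<and> j < k \<and> k < Suc N1 \<longrightarrow> f (e i) (e j) (e k) = v)"
    by (rule exE)
  show ?thesis
  proof (rule exI[of _ N], intro allI impI)
    fix A :: "nat \<Rightarrow> (real^2) set"
    assume conv: "\<forall>i<N. convex (A i)" and int: "\<forall>i<N. \<forall>j<N. A i \<inter> A j \<noteq> {}"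
      and disj: "\<forall>i<N. \<forall>j<N. \<forall>k<N. i \<noteq> j \<and> j \<noteq> k \<and> i \<noteq> k \<longrightarrow> A i \<inter> A j \<inter> A k = {}"
    \<comment> \<open>The choice depends on the intersection only, which makes \<open>x\<close>
      symmetric.\<close>
    define x where "x = (\<lambda>i j. SOME u. u \<in> A i \<inter> A j)"
    have x: "x i j \<in> A i" "x i j \<in> A j" "x i j = x j i" if "i < N" "j < N" for i j
      using someI_ex[of "\<lambda>u. u \<in> A i \<inter> A j"] int that by (auto simp: x_def conj_commute)
    from N[rule_format, of "\<lambda>_ _ _. True"] have "0 < N" by (metis gr0I less_zeroE zero_less_Suc)
    \<comment> \<open>Helly's theorem on the first axis: with c the largest of these leftmost
      abscissas, every set has chosen points on both weak sides of c.\<close>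
    define l where "l = (\<lambda>i. Min ((\<lambda>j. x i j $ 1) ` {..<N}))"
    define c where "c = Max (l ` {..<N})"
    have "\<exists>u. u \<in> A i \<and> u $ 1 = c" if i: "i < N" for i
    proof -
      have "l i \<in> (\<lambda>j. x i j $ 1) ` {..<N}" unfolding l_def using \<open>0 < N\<close> by (intro Min_in) auto
      then obtain j where j: "j < N" "x i j $ 1 = l i" by auto
      have "l i \<le> c" unfolding c_def using i by (intro Max_ge) auto
      have "c \<in> l ` {..<N}" unfolding c_def using \<open>0 < N\<close> by (intro Max_in) auto
      then obtain k where k: "k < N" "c = l k" by auto
      have "l k \<le> x k i $ 1" unfolding l_def using i by (intro Min_le) auto
      with k x(3)[of k i] i have "c \<le> x i k $ 1" by auto
      moreover have "linear (\<lambda>u::real^2. u $ 1)" by (auto intro!: linearI)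
      ultimately obtain t where "t \<in> closed_segment (x i j) (x i k)" "t $ 1 = c"
        using closed_segment_slice[of "\<lambda>u. u $ 1" "x i j" c "x i k"] j \<open>l i \<le> c\<close> by auto
      then show ?thesis
        using closed_segment_subset[of "x i j" "A i" "x i k"] x i j k conv by blast
    qed
    then obtain y where y: "\<And>i. i < N \<Longrightarrow> y i \<in> A i \<and> y i $ 1 = c" by metis
    \<comment> \<open>All intersection points come to lie on one side of c; the sign
      \<open>s\<close> then makes it the right side.\<close>
    from N[rule_format, of "\<lambda>i j k. c \<le> x i j $ 1"]
    obtain e1 v where e1: "strict_mono_on {..<Suc N1} e1" and e1N: "\<forall>i<Suc N1. e1 i < N" and
      v: "\<forall>i j k. i < j \<and> j < k \<and> k < Suc N1 \<longrightarrow> (c \<le> x (e1 i) (e1 j) $ 1) = v"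
      by (elim exE conjE) (rule that)
    define s :: real where "s = (if v then 1 else -1)"
    define X :: "real^2 \<Rightarrow> real" where "X = (\<lambda>u. s * u $ 1)"
    have lin: "linear X" by (auto simp: X_def algebra_simps intro!: linearI)
    have inj: "u = v" if "X u = X v" "u $ 2 = v $ 2" for u v
      using that by (auto simp: X_def s_def vec_eq_iff forall_2 split: if_splits)
    have lt: "e1 i < e1 j" if "i < j" "j < N1" for i j
      using e1 that by (simp add: strict_mono_on_def)
    have cx': "s * c \<le> X (x (e1 i) (e1 j))" if "i < j" "j < N1" for i j
      using v[rule_format, of i j N1] that by (auto simp: X_def s_def split: if_splits)
    have cx: "s * c \<le> X (x (e1 i) (e1 j))" if "i \<noteq> j" "i < N1" "j < N1" for i j
      using cx'[of i j] cx'[of j i] that x(3)[of "e1 i" "e1 j"] e1N by (cases i j rule: linorder_cases) auto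
    define \<rho> where "\<rho> = (\<lambda>i. Max ((\<lambda>j. X (x (e1 i) (e1 j))) ` {..<N1}))"
    have \<rho>_ge: "X (x (e1 i) (e1 j)) \<le> \<rho> i" if "j < N1" for i j
      unfolding \<rho>_def using that by (intro Max_ge) auto
    have \<rho>_in: "\<exists>u. u \<in> A (e1 i) \<and> X u = \<rho> i" if "i < N1" for i
    proof -
      have "\<rho> i \<in> (\<lambda>j. X (x (e1 i) (e1 j))) ` {..<N1}"
        unfolding \<rho>_def using that by (intro Max_in) auto
      then obtain j where "j < N1" "\<rho> i = X (x (e1 i) (e1 j))" by auto
      then show ?thesis using x(1)[of "e1 i" "e1 j"] e1N that by (intro exI[of _ "x (e1 i) (e1 j)"]) auto
    qed
    \<comment> \<open>Sorted by reach, a later set extends from the common line past the reach of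
      every earlier one; this yields the points \<open>z i j\<close>.\<close>
    obtain \<pi> where \<pi>: "bij_betw \<pi> {..<N1} {..<N1}" "\<And>i j. \<lbrakk>i < j; j < N1\<rbrakk> \<Longrightarrow> \<rho> (\<pi> i) \<le> \<rho> (\<pi> j)"
      using ex_sorting_bij[of N1 \<rho>] by metis
    have \<pi>_less: "\<pi> i < N1" if "i < N1" for i using \<pi>(1) that by (auto simp: bij_betw_def)
    have \<pi>_eq: "\<pi> i = \<pi> j \<longleftrightarrow> i = j" if "i < N1" "j < N1" for i j
      using \<pi>(1) that by (auto simp: bij_betw_def inj_on_def)
    define f where "f = (\<lambda>i. e1 (\<pi> i))"
    have e1_eq: "e1 i = e1 j \<longleftrightarrow> i = j" if "i < N1" "j < N1" for i j
      using lt[of i j] lt[of j i] that by (cases i j rule: linorder_cases) auto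
    have fN: "f i < N" if "i < N1" for i using e1N \<pi>_less[OF that] by (auto simp: f_def)
    have f_eq: "f i = f j \<longleftrightarrow> i = j" if "i < N1" "j < N1" for i j
      using e1_eq[of "\<pi> i" "\<pi> j"] \<pi>_less \<pi>_eq that by (auto simp: f_def)
    have "\<exists>u. u \<in> A (f j) \<and> X u = \<rho> (\<pi> i)" if ij: "i < j" "j < N1" for i j
    proof -
      obtain w where w: "w \<in> A (f j)" "X w = \<rho> (\<pi> j)" using \<rho>_in[of "\<pi> j"] \<pi>_less ij by (auto simp: f_def)
      have "s * c \<le> \<rho> (\<pi> i)"
        using cx[of "\<pi> i" "\<pi> j"] \<rho>_ge[of "\<pi> j" "\<pi> i"] \<pi>_eq[of i j] \<pi>_less[of i] \<pi>_less[of j] ij by auto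
      moreover have "X (y (f j)) = s * c" using y fN ij by (auto simp: X_def)
      ultimately obtain t where "t \<in> closed_segment (y (f j)) w" "X t = \<rho> (\<pi> i)"
        using closed_segment_slice[OF lin, of "y (f j)" "\<rho> (\<pi> i)" w] w \<pi>(2)[OF ij] by auto
      then show ?thesis
        using closed_segment_subset[of "y (f j)" "A (f j)" w] y[of "f j"] fN[of j] ij conv w by auto
    qed
    then obtain z where z: "\<And>i j. \<lbrakk>i < j; j < N1\<rbrakk> \<Longrightarrow> z i j \<in> A (f j) \<and> X (z i j) = \<rho> (\<pi> i)" by metis
    have "\<exists>e p q. strict_mono_on {..<m} e \<and> (\<forall>i<m. e i < N1 \<and> p i \<in> A (f (e i)) \<and> q i \<in> A (f (e i))) \<and>
      (\<forall>i j. i < j \<and> j < m \<longrightarrow> closed_segment (p i) (q i) \<inter> closed_segment (p j) (q j) \<noteq> {})"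
    proof (rule sorted_chain_crossing_segments[OF N1 lin inj, where x = "\<lambda>i j. x (f i) (f j)" and c = "s * c"
          and \<rho> = "\<lambda>i. \<rho> (\<pi> i)" and y = "\<lambda>i. y (f i)" and z = z])
      fix i j assume ij: "i < j" "j < N1"
      show "x (f i) (f j) \<in> A (f i) \<inter> A (f j)" using x fN ij by auto
      show "s * c \<le> X (x (f i) (f j)) \<and> X (x (f i) (f j)) \<le> \<rho> (\<pi> i)"
        using cx[of "\<pi> i" "\<pi> j"] \<rho>_ge[of "\<pi> j" "\<pi> i"] \<pi>_eq[of i j] \<pi>_less[of i] \<pi>_less[of j] ij by (auto simp: f_def)
      show "z i j \<in> A (f j) \<and> X (z i j) = \<rho> (\<pi> i)" using z ij by auto
    next
      fix i j k assume "i < j" "j < k" "k < N1"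
      then show "A (f i) \<inter> A (f j) \<inter> A (f k) = {}"
        using fN[of i] fN[of j] fN[of k] f_eq[of i j] f_eq[of j k] f_eq[of i k]
        by (intro disj[rule_format]) auto
    qed (use conv fN y in \<open>auto simp: X_def\<close>)
    then obtain e p q where e: "strict_mono_on {..<m} e" and pq: "\<forall>i<m. e i < N1 \<and> p i \<in> A (f (e i)) \<and> q i \<in> A (f (e i))"
      "\<forall>i j. i < j \<and> j < m \<longrightarrow> closed_segment (p i) (q i) \<inter> closed_segment (p j) (q j) \<noteq> {}"
      by (elim exE conjE) (rule that)
    have "inj_on (\<lambda>i. f (e i)) {..<m}"
    proof (rule inj_onI)
      fix i j assume "i \<in> {..<m}" "j \<in> {..<m}" "f (e i) = f (e j)"
      then show "i = j"
        using f_eq[of "e i" "e j"] pq(1) strict_mono_on_imp_inj_on[OF e] by (auto simp: inj_on_def)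
    qed
    with pq fN show "\<exists>e p q. inj_on e {..<m} \<and> (\<forall>i<m. e i < N \<and> p i \<in> A (e i) \<and> q i \<in> A (e i)) \<and>
       (\<forall>i j. i < j \<and> j < m \<longrightarrow> closed_segment (p i) (q i) \<inter> closed_segment (p j) (q j) \<noteq> {})"
      by (intro exI[of _ "\<lambda>i. f (e i)"] exI[of _ p] exI[of _ q]) auto
  qed
qed

section \<open>Lines and planes in coordinates\<close>

definition line2 :: "real \<Rightarrow> real \<Rightarrow> (real^2) set" where
  "line2 a b = {w. w $ 2 = a * w $ 1 + b}"

text \<open>Parametrising by the first coordinate also excludes lines whose projection is parallel
  to the second axis, which cups and caps do not admit.\<close>

definition line3 :: "real \<Rightarrow> real \<Rightarrow> real \<Rightarrow> real \<Rightarrow> (real^3) set" where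
  "line3 a b c d = {v. v $ 2 = a * v $ 1 + b \<and> v $ 3 = c * v $ 1 + d}"

definition point3 :: "real \<Rightarrow> real \<Rightarrow> real \<Rightarrow> real \<Rightarrow> real \<Rightarrow> real^3" where
  "point3 a b c d x = vector [x, a * x + b, c * x + d]"

definition plane3 :: "real \<Rightarrow> real \<Rightarrow> real \<Rightarrow> (real^3) set" where
  "plane3 \<alpha> \<beta> \<gamma> = {v. v $ 3 = \<alpha> + \<beta> * v $ 1 + \<gamma> * v $ 2}"

lemma vproj_nth [simp]: "vproj v $ 1 = v $ 1" "vproj v $ 2 = v $ 2"
  by (simp_all add: vproj_def)

lemma linear_vproj: "linear vproj"
  by (auto intro!: linearI simp: vec_eq_iff forall_2)

lemma point3_nth [simp]:
  "point3 a b c d x $ 1 = x" "point3 a b c d x $ 2 = a * x + b" "point3 a b c d x $ 3 = c * x + d"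
  by (simp_all add: point3_def)

lemma mem_line3_iff: "v \<in> line3 a b c d \<longleftrightarrow> v = point3 a b c d (v $ 1)"
  by (auto simp: line3_def vec_eq_iff forall_3)

lemma point3_mem_line3 [simp]: "point3 a b c d x \<in> line3 a b c d"
  by (simp add: line3_def)

lemma vproj_line3: "vproj ` line3 a b c d = line2 a b"
proof -
  have "w \<in> vproj ` line3 a b c d" if "w \<in> line2 a b" for w
    using that by (intro image_eqI[of _ _ "point3 a b c d (w $ 1)"]) (auto simp: line2_def vec_eq_iff forall_2)
  then show ?thesis by (auto simp: line3_def line2_def)
qed

lemma line3_eq_hull: "line3 a b c d = affine hull {point3 a b c d 0, point3 a b c d 1}"
proof -
  have "v = (1 - v $ 1) *\<^sub>R point3 a b c d 0 + (v $ 1) *\<^sub>R point3 a b c d 1" if "v \<in> line3 a b c d" for v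
    using that by (auto simp: line3_def vec_eq_iff forall_3 algebra_simps)
  moreover have "s *\<^sub>R point3 a b c d 0 + t *\<^sub>R point3 a b c d 1 \<in> line3 a b c d" if "s + t = 1" for s t
  proof -
    have s: "s = 1 - t" using that by simp
    show ?thesis unfolding s by (simp add: line3_def algebra_simps)
  qed
  ultimately show ?thesis
    unfolding affine_hull_2 by (fastforce intro: diff_add_cancel)
qed

lemma is_line_line3: "is_line (line3 a b c d)"
proof -
  have "point3 a b c d 0 \<noteq> point3 a b c d 1" by (metis point3_nth(1) zero_neq_one)
  then show ?thesis by (simp add: is_line_def line3_eq_hull)
qed

lemma is_line_line2: "is_line (line2 a b)"
proof -
  let ?P = "\<lambda>x. vector [x, a * x + b] :: real^2"
  have "v = (1 - v $ 1) *\<^sub>R ?P 0 + (v $ 1) *\<^sub>R ?P 1" if "v \<in> line2 a b" for v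
    using that by (auto simp: line2_def vec_eq_iff forall_2 algebra_simps)
  moreover have "s *\<^sub>R ?P 0 + t *\<^sub>R ?P 1 \<in> line2 a b" if "s + t = 1" for s t
  proof -
    have s: "s = 1 - t" using that by simp
    show ?thesis unfolding s by (simp add: line2_def algebra_simps)
  qed
  ultimately have "line2 a b = affine hull {?P 0, ?P 1}"
    unfolding affine_hull_2 by (fastforce intro: diff_add_cancel)
  moreover have "?P 0 \<noteq> ?P 1" by (metis vector_2(1) zero_neq_one)
  ultimately show ?thesis by (simp add: is_line_def)
qed

lemma convex_line3: "convex (line3 a b c d)"
  using is_line_line3 by (auto simp: is_line_def intro: affine_imp_convex)

lemma nonvertical3_line3: "nonvertical3 (line3 a b c d)"
proof -
  have "line3 a b c d \<noteq> vline p" for p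
  proof
    assume "line3 a b c d = vline p"
    then have "point3 a b c d 0 \<in> vline p" "point3 a b c d 1 \<in> vline p"
      using point3_mem_line3 by (metis (no_types))+
    then have "vproj (point3 a b c d 0) = vproj (point3 a b c d 1)" by (simp add: vline_def)
    then show False by (metis point3_nth(1) vproj_nth(1) zero_neq_one)
  qed
  then show ?thesis by (simp add: nonvertical3_def is_line_line3)
qed

lemma nonvertical2_line2: "nonvertical2 (line2 a b)"
proof -
  have "line2 a b \<noteq> {x. x $ 1 = s}" for s
  proof
    assume "line2 a b = {x. x $ 1 = s}"
    moreover have "vector [s+1, a * (s+1) + b] \<in> line2 a b" by (simp add: line2_def)
    ultimately show False by auto
  qed
  then show ?thesis by (simp add: nonvertical2_def is_line_line2)
qed

lemma slope_line2: "slope (line2 a b) = a"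
  unfolding slope_def
proof (rule the_equality)
  show "\<forall>x\<in>line2 a b. \<forall>y\<in>line2 a b. y $ 2 - x $ 2 = a * (y $ 1 - x $ 1)"
    by (auto simp: line2_def algebra_simps)
next
  fix m assume "\<forall>x\<in>line2 a b. \<forall>y\<in>line2 a b. y $ 2 - x $ 2 = m * (y $ 1 - x $ 1)"
  moreover have "vector [0, b] \<in> line2 a b" "vector [1, a + b] \<in> line2 a b" by (auto simp: line2_def)
  ultimately have "(vector [1, a + b] :: real^2) $ 2 - (vector [0, b] :: real^2) $ 2 =
      m * ((vector [1, a + b] :: real^2) $ 1 - (vector [0, b] :: real^2) $ 1)"
    by blast
  then show "m = a" by simp
qed

lemma affine_parallel_line2:
  assumes "affine_parallel (line2 a b) (line2 a' b')"
  shows "a = a'"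
proof -
  obtain t where t: "line2 a' b' = (\<lambda>x. t + x) ` line2 a b"
    using assms by (auto simp: affine_parallel_def)
  have "vector [0, b] \<in> line2 a b" "vector [1, a + b] \<in> line2 a b" by (auto simp: line2_def)
  then have "t + vector [0, b] \<in> line2 a' b'" "t + vector [1, a + b] \<in> line2 a' b'"
    unfolding t by blast+
  then show ?thesis by (auto simp: line2_def algebra_simps)
qed

lemma line2_Int_line2:
  assumes "a \<noteq> a'"
  shows "line2 a b \<inter> line2 a' b' = {vector [(b' - b) / (a - a'), a * ((b' - b) / (a - a')) + b]}"
proof -
  define x where "x = (b' - b) / (a - a')"
  have x: "a * t + b = a' * t + b' \<longleftrightarrow> t = x" for t
    using assms by (auto simp: x_def field_simps)
  have "w \<in> line2 a b \<inter> line2 a' b' \<longleftrightarrow> w = vector [x, a * x + b]" for w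
    using x[of "w $ 1"] x[of x] by (auto simp: line2_def vec_eq_iff forall_2)
  then show ?thesis unfolding x_def by blast
qed

lemma cross_pt_line3:
  assumes "a \<noteq> a'"
  shows "cross_pt (line3 a b c d) (line3 a' b' c' d') = point3 a b c d ((b' - b) / (a - a'))"
proof -
  define x where "x = (b' - b) / (a - a')"
  have x: "a * t + b = a' * t + b' \<longleftrightarrow> t = x" for t
    using assms by (auto simp: x_def field_simps)
  have meets: "vline p \<inter> line3 a' b' c' d' \<noteq> {} \<longleftrightarrow> p $ 2 = a' * p $ 1 + b'" for p
  proof
    assume "vline p \<inter> line3 a' b' c' d' \<noteq> {}"
    then obtain u where "vproj u = vproj p" "u \<in> line3 a' b' c' d'" by (auto simp: vline_def)
    then show "p $ 2 = a' * p $ 1 + b'" by (simp add: line3_def) (metis vproj_nth)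
  next
    assume "p $ 2 = a' * p $ 1 + b'"
    then have "point3 a' b' c' d' (p $ 1) \<in> vline p"
      by (auto simp: vline_def vec_eq_iff forall_2)
    then show "vline p \<inter> line3 a' b' c' d' \<noteq> {}" using point3_mem_line3 by blast
  qed
  show ?thesis
    unfolding cross_pt_def meets x_def[symmetric]
  proof (rule the_equality)
    show "point3 a b c d x \<in> line3 a b c d \<and> point3 a b c d x $ 2 = a' * point3 a b c d x $ 1 + b'"
      using x[of x] by simp
  next
    fix p assume p: "p \<in> line3 a b c d \<and> p $ 2 = a' * p $ 1 + b'"
    then have "p $ 1 = x" using x[of "p $ 1"] by (simp add: line3_def)
    then show "p = point3 a b c d x" using p mem_line3_iff by metis
  qed
qed

lemma is_plane_plane3: "is_plane (plane3 \<alpha> \<beta> \<gamma>)"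
proof -
  let ?n = "vector [- \<beta>, - \<gamma>, 1] :: real^3"
  have "plane3 \<alpha> \<beta> \<gamma> = {v. ?n \<bullet> v = \<alpha>}"
    by (auto simp: plane3_def inner_vec_def sum_3 algebra_simps)
  moreover have "?n \<noteq> 0" by (metis vector_3(3) zero_index zero_neq_one)
  ultimately show ?thesis by (simp add: is_plane_def affine_hyperplane)
qed

text \<open>The vertical segment from \<open>u\<close> to \<open>v\<close> lies in the bridge and
  attains every height between those of its ends.\<close>

lemma separates_plane3:
  assumes "u \<in> A" "v \<in> B" "vproj u = vproj v"
    and "u $ 3 \<le> h \<and> h \<le> v $ 3 \<or> v $ 3 \<le> h \<and> h \<le> u $ 3"
    and "h = \<alpha> + \<beta> * u $ 1 + \<gamma> * u $ 2"
  shows "separates (plane3 \<alpha> \<beta> \<gamma>) A B"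
proof -
  have "linear (\<lambda>w::real^3. w $ 3)" by (auto intro!: linearI)
  then obtain t where t: "t \<in> closed_segment u v" "t $ 3 = h"
    using closed_segment_slice[of "\<lambda>w. w $ 3" u h v] assms(4) by metis
  have "vproj t = vproj u"
    using t(1) assms(3) closed_segment_linear_image[OF linear_vproj, of u v] by auto
  then have "t $ 1 = u $ 1" "t $ 2 = u $ 2" by (metis vproj_nth(1), metis vproj_nth(2))
  then have "t \<in> plane3 \<alpha> \<beta> \<gamma>" using t assms(5) by (simp add: plane3_def)
  moreover have "u \<in> A \<inter> vcyl B" "v \<in> B \<inter> vcyl A"
    using assms(1-3) unfolding vcyl_def vline_def by (auto, metis)
  then have "closed_segment u v \<subseteq> bridge A B"
    unfolding bridge_def by (intro closed_segment_subset) (auto intro: hull_inc)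
  ultimately show ?thesis using t(1) by (auto simp: separates_def)
qed

text \<open>\<sigma> = -1 encodes the reflection in the first axis, which exchanges cups and caps
  while the order of the lines is kept.\<close>

lemma cup_cap_line2:
  fixes a b :: "nat \<Rightarrow> real" and \<sigma> :: real
  assumes q: "3 \<le> q" and \<sigma>: "\<sigma> = 1 \<or> \<sigma> = -1"
    and a: "\<And>i j. \<lbrakk>1 \<le> i; i < j; j \<le> q\<rbrakk> \<Longrightarrow> \<sigma> * a i < \<sigma> * a j"
    and cup: "\<And>i j k x. \<lbrakk>1 \<le> i; i < j; j < k; k \<le> q; x = line_family.X a b i k\<rbrakk> \<Longrightarrow>
       \<sigma> * (a i * x + b i) < \<sigma> * (a j * x + b j)"
  shows "is_cup q (\<lambda>i. line2 (a i) (b i)) \<or> is_cap q (\<lambda>i. line2 (a i) (b i))"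
proof -
  have int: "line2 (a i) (b i) \<inter> line2 (a k) (b k) =
      {vector [line_family.X a b i k, a i * line_family.X a b i k + b i]}" if "1 \<le> i" "i < k" "k \<le> q" for i k
  proof -
    have "a i \<noteq> a k" using a[OF that] by auto
    then show ?thesis by (simp add: line2_Int_line2 line_family.X_def)
  qed
  have simple: "simple_lines q (\<lambda>i. line2 (a i) (b i))"
  proof -
    have "line2 (a i) (b i) \<inter> line2 (a j) (b j) \<inter> line2 (a k) (b k) = {}"
      if "1 \<le> i" "i < j" "j < k" "k \<le> q" for i j k
    proof -
      have "vector [line_family.X a b i k, a i * line_family.X a b i k + b i] \<notin> line2 (a j) (b j)"
        using cup[OF that refl] by (auto simp: line2_def)
      moreover have "line2 (a i) (b i) \<inter> line2 (a j) (b j) \<inter> line2 (a k) (b k) =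
          line2 (a i) (b i) \<inter> line2 (a k) (b k) \<inter> line2 (a j) (b j)" by blast
      ultimately show ?thesis using int[of i k] that by simp
    qed
    then show ?thesis using q by (auto simp: simple_lines_def nonvertical2_line2)
  qed
  from \<sigma> show ?thesis
  proof
    assume s: "\<sigma> = 1"
    have "pt_below (vector [x, a i * x + b i]) (line2 (a j) (b j))"
      if "1 \<le> i" "i < j" "j < k" "k \<le> q" "x = line_family.X a b i k" for i j k x
      unfolding pt_below_def using cup[OF that] s
      by (intro bexI[of _ "vector [x, a j * x + b j]"]) (auto simp: line2_def)
    then have "is_cup q (\<lambda>i. line2 (a i) (b i))"
      using simple a s int by (auto simp: is_cup_def slope_line2)
    then show ?thesis ..
  next
    assume s: "\<sigma> = -1"
    have "pt_above (vector [x, a i * x + b i]) (line2 (a j) (b j))"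
      if "1 \<le> i" "i < j" "j < k" "k \<le> q" "x = line_family.X a b i k" for i j k x
      unfolding pt_above_def using cup[OF that] s
      by (intro bexI[of _ "vector [x, a j * x + b j]"]) (auto simp: line2_def)
    then have "is_cap q (\<lambda>i. line2 (a i) (b i))"
      using simple a s int by (auto simp: is_cap_def slope_line2)
    then show ?thesis ..
  qed
qed

lemma monotone_lines_line3:
  fixes a b c d :: "nat \<Rightarrow> real" and \<sigma> \<tau> :: real
  assumes q: "3 \<le> q" and \<sigma>: "\<sigma> = 1 \<or> \<sigma> = -1" and \<tau>: "\<tau> = 1 \<or> \<tau> = -1"
    and a: "\<And>i j. \<lbrakk>1 \<le> i; i < j; j \<le> q\<rbrakk> \<Longrightarrow> \<sigma> * a i < \<sigma> * a j"
    and cup: "\<And>i j k x. \<lbrakk>1 \<le> i; i < j; j < k; k \<le> q; x = line_family.X a b i k\<rbrakk> \<Longrightarrow>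
       \<sigma> * (a i * x + b i) < \<sigma> * (a j * x + b j)"
    and F: "\<And>i j. \<lbrakk>1 \<le> i; i < j; j \<le> q\<rbrakk> \<Longrightarrow>
       \<tau> * line_family.F a b c d i j \<le> \<tau> * line_family.F a b c d j i"
  shows "monotone_lines q (\<lambda>i. line3 (a i) (b i) (c i) (d i))"
proof -
  let ?l = "\<lambda>i. line3 (a i) (b i) (c i) (d i)"
  have cross: "cross_pt (?l i) (?l j) = point3 (a i) (b i) (c i) (d i) (line_family.X a b i j)" 
    "cross_pt (?l j) (?l i) = point3 (a j) (b j) (c j) (d j) (line_family.X a b i j)"
    "a i * line_family.X a b i j + b i = a j * line_family.X a b i j + b j"
    if "1 \<le> i" "i < j" "j \<le> q" for i j
  proof -
    have ne: "a i \<noteq> a j" using a[OF that] by auto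
    show "cross_pt (?l i) (?l j) = point3 (a i) (b i) (c i) (d i) (line_family.X a b i j)"
      unfolding line_family.X_def by (rule cross_pt_line3[OF ne])
    show "cross_pt (?l j) (?l i) = point3 (a j) (b j) (c j) (d j) (line_family.X a b i j)"
      by (subst line_family.X_commute) (simp add: line_family.X_def cross_pt_line3 ne[symmetric])
    show "a i * line_family.X a b i j + b i = a j * line_family.X a b i j + b j"
      using ne by (simp add: line_family.X_def field_simps)
  qed
  \<comment> \<open>Equality of heights means that the lines meet, which the weak relations accept;
    weak inequalities in \<open>F\<close> thus suffice.\<close>
  have meet: "?l i \<inter> ?l j \<noteq> {}" if "1 \<le> i" "i < j" "j \<le> q" "cross_pt (?l i) (?l j) $ 3 = cross_pt (?l j) (?l i) $ 3" for i j
  proof -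
    have "cross_pt (?l i) (?l j) = cross_pt (?l j) (?l i)"
      using that cross[of i j] by (simp add: vec_eq_iff forall_3)
    then show ?thesis using cross[of i j] that point3_mem_line3 by (metis IntI empty_iff)
  qed
  have F': "\<tau> * cross_pt (?l i) (?l j) $ 3 \<le> \<tau> * cross_pt (?l j) (?l i) $ 3" if "1 \<le> i" "i < j" "j \<le> q" for i j
    using F[OF that] cross[OF that] line_family.X_commute[of a b i j] by (simp add: line_family.F_def)
  from \<tau> have "(\<forall>i\<in>{1..<q}. line_below_eq (?l i) (?l (Suc i))) \<or> (\<forall>i\<in>{1..<q}. line_above_eq (?l i) (?l (Suc i)))"
  proof
    assume "\<tau> = 1"
    then have "line_below_eq (?l i) (?l (Suc i))" if "i \<in> {1..<q}" for i
      using F'[of i "Suc i"] meet[of i "Suc i"] that by (auto simp: line_below_eq_def line_below_def)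
    then show ?thesis by blast
  next
    assume "\<tau> = -1"
    then have "line_above_eq (?l i) (?l (Suc i))" if "i \<in> {1..<q}" for i
      using F'[of i "Suc i"] meet[of i "Suc i"] that by (auto simp: line_above_eq_def line_above_def)
    then show ?thesis by blast
  qed
  moreover have "is_cup q (\<lambda>i. line2 (a i) (b i)) \<or> is_cap q (\<lambda>i. line2 (a i) (b i))"
  proof (rule cup_cap_line2[OF q \<sigma>])
    show "\<sigma> * a i < \<sigma> * a j" if "1 \<le> i" "i < j" "j \<le> q" for i j
      by (rule a[OF that])
    show "\<sigma> * (a i * x + b i) < \<sigma> * (a j * x + b j)"
      if "1 \<le> i" "i < j" "j < k" "k \<le> q" "x = line_family.X a b i k" for i j k x
      by (rule cup[OF that])
  qed
  ultimately show ?thesis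
    by (auto simp: monotone_lines_def nonvertical3_line3 vproj_line3)
qed

section \<open>Realization by monotone lines\<close>

text \<open>The middle point is between the other two, and both of these belong to the one set that
  it is not yet known to lie in.\<close>

lemma collinear_pairwise_points_meet:
  fixes A B C :: "'a::euclidean_space set"
  assumes "convex A" "convex B" "convex C" "p \<in> A \<inter> B" "q \<in> A \<inter> C" "r \<in> B \<inter> C" "collinear {p, q, r}"
  shows "A \<inter> B \<inter> C \<noteq> {}"
proof -
  have "p \<in> closed_segment q r \<or> q \<in> closed_segment r p \<or> r \<in> closed_segment p q"
    using assms(7) unfolding collinear_between_cases between_mem_segment .
  then show ?thesis
    using assms closed_segment_subset[of q C r] closed_segment_subset[of r B p] closed_segment_subset[of p A q]
    by blast
qed

lemma collinear_line2:
  assumes "S \<subseteq> line2 a b"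
  shows "collinear S"
  unfolding collinear_def
proof (intro exI[of _ "vector [1, a]"] ballI)
  fix u v assume "u \<in> S" "v \<in> S"
  then have "u \<in> line2 a b" "v \<in> line2 a b" using assms by auto
  then show "\<exists>t. u - v = t *\<^sub>R (vector [1, a] :: real^2)"
    by (intro exI[of _ "u $ 1 - v $ 1"]) (auto simp: line2_def vec_eq_iff forall_2 algebra_simps)
qed

lemma collinear_vertical2:
  fixes S :: "(real^2) set"
  assumes "\<And>u. u \<in> S \<Longrightarrow> u $ 1 = s"
  shows "collinear S"
  unfolding collinear_def
proof (intro exI[of _ "vector [0, 1]"] ballI)
  fix u v assume "u \<in> S" "v \<in> S"
  then have "u $ 1 = s" "v $ 1 = s" using assms by auto
  then show "\<exists>t. u - v = t *\<^sub>R (vector [0, 1] :: real^2)"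
    by (intro exI[of _ "u $ 2 - v $ 2"]) (auto simp: vec_eq_iff forall_2)
qed

lemma line3_through:
  assumes "u $ 1 \<noteq> v $ 1"
  shows "\<exists>a b c d. u \<in> line3 a b c d \<and> v \<in> line3 a b c d"
proof -
  define a where "a = (v $ 2 - u $ 2) / (v $ 1 - u $ 1)"
  define c where "c = (v $ 3 - u $ 3) / (v $ 1 - u $ 1)"
  have "v $ 2 - u $ 2 = a * (v $ 1 - u $ 1)" "v $ 3 - u $ 3 = c * (v $ 1 - u $ 1)"
    using assms by (auto simp: a_def c_def)
  then have "u \<in> line3 a (u $ 2 - a * u $ 1) c (u $ 3 - c * u $ 1) \<and> v \<in> line3 a (u $ 2 - a * u $ 1) c (u $ 3 - c * u $ 1)"
    by (auto simp: line3_def algebra_simps)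
  then show ?thesis by blast
qed

lemma ex_crossing_lines:
  fixes m :: nat
  shows "\<exists>N. \<forall>K :: nat \<Rightarrow> (real^3) set.
     (\<forall>i<N. convex (K i)) \<longrightarrow> (\<forall>i<N. \<forall>j<N. K i \<inter> K j \<noteq> {}) \<longrightarrow>
     (\<forall>i<N. \<forall>j<N. \<forall>k<N. i \<noteq> j \<and> j \<noteq> k \<and> i \<noteq> k \<longrightarrow> vproj ` K i \<inter> vproj ` K j \<inter> vproj ` K k = {}) \<longrightarrow>
     (\<exists>e a b c d. inj_on e {..<m} \<and> (\<forall>i<m. e i < N) \<and>
       (\<forall>i<m. \<forall>j<m. i \<noteq> j \<longrightarrow> vproj ` (K (e i) \<inter> line3 (a i) (b i) (c i) (d i)) \<inter>
          vproj ` (K (e j) \<inter> line3 (a j) (b j) (c j) (d j)) \<noteq> {}))"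
proof -
  from ex_pairwise_crossing_segments[of "m+2"]
  obtain N where N: "\<forall>A :: nat \<Rightarrow> (real^2) set.
     (\<forall>i<N. convex (A i)) \<longrightarrow> (\<forall>i<N. \<forall>j<N. A i \<inter> A j \<noteq> {}) \<longrightarrow>
     (\<forall>i<N. \<forall>j<N. \<forall>k<N. i \<noteq> j \<and> j \<noteq> k \<and> i \<noteq> k \<longrightarrow> A i \<inter> A j \<inter> A k = {}) \<longrightarrow>
     (\<exists>e p q. inj_on e {..<m+2} \<and> (\<forall>i<m+2. e i < N \<and> p i \<in> A (e i) \<and> q i \<in> A (e i)) \<and>
       (\<forall>i j. i < j \<and> j < m+2 \<longrightarrow> closed_segment (p i) (q i) \<inter> closed_segment (p j) (q j) \<noteq> {}))"
    by (rule exE)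
  show ?thesis
  proof (rule exI[of _ N], intro allI impI)
    fix K :: "nat \<Rightarrow> (real^3) set"
    assume conv: "\<forall>i<N. convex (K i)" and int: "\<forall>i<N. \<forall>j<N. K i \<inter> K j \<noteq> {}"
      and disj: "\<forall>i<N. \<forall>j<N. \<forall>k<N. i \<noteq> j \<and> j \<noteq> k \<and> i \<noteq> k \<longrightarrow> vproj ` K i \<inter> vproj ` K j \<inter> vproj ` K k = {}"
    have conv': "\<forall>i<N. convex (vproj ` K i)" using conv linear_vproj convex_linear_image by blast
    have int': "\<forall>i<N. \<forall>j<N. vproj ` K i \<inter> vproj ` K j \<noteq> {}" using int by blast
    obtain e p q where e: "inj_on e {..<m+2}" and
      pq: "\<forall>i<m+2. e i < N \<and> p i \<in> vproj ` K (e i) \<and> q i \<in> vproj ` K (e i)" and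
      seg: "\<forall>i j. i < j \<and> j < m+2 \<longrightarrow> closed_segment (p i) (q i) \<inter> closed_segment (p j) (q j) \<noteq> {}"
      using mp[OF mp[OF mp[OF spec[OF N, of "\<lambda>i. vproj ` K i"] conv'] int'] disj]
      by (elim exE conjE) (rule that)
    have seg': "closed_segment (p i) (q i) \<inter> closed_segment (p j) (q j) \<noteq> {}"
      if "i \<noteq> j" "i < m+2" "j < m+2" for i j
      using seg[rule_format, of i j] seg[rule_format, of j i] that by (cases i j rule: linorder_cases) auto
    have sub: "closed_segment (p i) (q i) \<subseteq> vproj ` K (e i)" if "i < m+2" for i
      using pq conv' that by (intro closed_segment_subset) auto
    \<comment> \<open>Segments parallel to the second axis cannot be lifted to a
      \<open>line3\<close>. Three of them, meeting pairwise, would lie on one line and give three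
      projected sets a common point; two spare sets therefore suffice.\<close>
    define V where "V = {i. i < m+2 \<and> p i $ 1 = q i $ 1}"
    have V: "w $ 1 = p i $ 1" if "w \<in> closed_segment (p i) (q i)" "i \<in> V" for w i
    proof -
      obtain s where "w = (1 - s) *\<^sub>R p i + s *\<^sub>R q i" using \<open>w \<in> _\<close> by (auto simp: in_segment)
      then have "w $ 1 = (1 - s) * p i $ 1 + s * q i $ 1" by simp
      then show ?thesis using \<open>i \<in> V\<close> by (simp add: V_def algebra_simps)
    qed
    have "card V \<le> 2"
    proof (rule ccontr)
      assume "\<not> card V \<le> 2"
      then have "3 \<le> card V" by simp
      then obtain T where "T \<subseteq> V" "card T = 3" by (meson obtain_subset_with_card_n)
      then obtain i j k where ijk: "i \<in> V" "j \<in> V" "k \<in> V" "i \<noteq> j" "j \<noteq> k" "i \<noteq> k"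
        by (auto simp: card_3_iff)
      then have lt: "i < m+2" "j < m+2" "k < m+2" by (auto simp: V_def)
      obtain u v w where u: "u \<in> closed_segment (p i) (q i)" "u \<in> closed_segment (p j) (q j)"
        and v: "v \<in> closed_segment (p i) (q i)" "v \<in> closed_segment (p k) (q k)"
        and w: "w \<in> closed_segment (p j) (q j)" "w \<in> closed_segment (p k) (q k)"
        using seg'[of i j] seg'[of i k] seg'[of j k] ijk lt by auto
      have "collinear {u, v, w}"
        using V[OF u(1)] V[OF u(2)] V[OF v(1)] V[OF w(1)] ijk
        by (intro collinear_vertical2[of _ "p i $ 1"]) auto
      then have "vproj ` K (e i) \<inter> vproj ` K (e j) \<inter> vproj ` K (e k) \<noteq> {}"
        using u v w sub lt conv' pq by (intro collinear_pairwise_points_meet[of _ _ _ u v w]) auto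
      moreover have "e i \<noteq> e j" "e j \<noteq> e k" "e i \<noteq> e k"
        using e ijk lt by (auto simp: inj_on_def)
      ultimately show False using disj pq lt by blast
    qed
    moreover have "V \<subseteq> {..<m+2}" by (auto simp: V_def)
    ultimately have "m \<le> card ({..<m+2} - V)" by (simp add: card_Diff_subset finite_subset)
    then obtain T where T: "T \<subseteq> {..<m+2} - V" "card T = m" "finite T" by (meson obtain_subset_with_card_n)
    then obtain f where f: "bij_betw f {..<m} T"
      using ex_bij_betw_nat_finite[of T] by (auto simp: atLeast0LessThan)
    have fT: "f i < m+2" "f i \<notin> V" if "i < m" for i
      using f T that by (auto simp: bij_betw_def)
    have f_eq: "f i = f j \<longleftrightarrow> i = j" if "i < m" "j < m" for i j
      using f that by (auto simp: bij_betw_def inj_on_def)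
    \<comment> \<open>Lifting the end points into the convex set lifts the whole segment into it, so
      crossings in the plane survive.\<close>
    have "\<exists>a b c d. closed_segment (p (f i)) (q (f i)) \<subseteq> vproj ` (K (e (f i)) \<inter> line3 a b c d)" if i: "i < m" for i
    proof -
      obtain u v where uv: "u \<in> K (e (f i))" "v \<in> K (e (f i))" "p (f i) = vproj u" "q (f i) = vproj v"
        using pq fT[OF i] by auto
      then have "u $ 1 \<noteq> v $ 1" using fT[OF i] by (auto simp: V_def)
      then obtain a b c d where "u \<in> line3 a b c d" "v \<in> line3 a b c d" using line3_through by metis
      then have "closed_segment u v \<subseteq> K (e (f i)) \<inter> line3 a b c d"
        using uv conv pq fT[OF i] convex_line3 by (simp add: closed_segment_subset)
      then have "vproj ` closed_segment u v \<subseteq> vproj ` (K (e (f i)) \<inter> line3 a b c d)" by blast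
      then show ?thesis unfolding uv closed_segment_linear_image[OF linear_vproj] by blast
    qed
    then obtain a b c d where abcd: "\<And>i. i < m \<Longrightarrow>
        closed_segment (p (f i)) (q (f i)) \<subseteq> vproj ` (K (e (f i)) \<inter> line3 (a i) (b i) (c i) (d i))"
      by metis
    show "\<exists>e a b c d. inj_on e {..<m} \<and> (\<forall>i<m. e i < N) \<and>
       (\<forall>i<m. \<forall>j<m. i \<noteq> j \<longrightarrow> vproj ` (K (e i) \<inter> line3 (a i) (b i) (c i) (d i)) \<inter>
          vproj ` (K (e j) \<inter> line3 (a j) (b j) (c j) (d j)) \<noteq> {})"
    proof (rule exI[of _ "\<lambda>i. e (f i)"], rule exI[of _ a], rule exI[of _ b], rule exI[of _ c], rule exI[of _ d],
        intro conjI allI impI)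
      show "inj_on (\<lambda>i. e (f i)) {..<m}"
      proof (rule inj_onI)
        fix i j assume "i \<in> {..<m}" "j \<in> {..<m}" "e (f i) = e (f j)"
        then show "i = j" using inj_onD[OF e, of "f i" "f j"] fT f_eq by auto
      qed
      fix i assume i: "i < m"
      show "e (f i) < N" using pq fT[OF i] by auto
      fix j assume j: "j < m" "i \<noteq> j"
      show "vproj ` (K (e (f i)) \<inter> line3 (a i) (b i) (c i) (d i)) \<inter>
          vproj ` (K (e (f j)) \<inter> line3 (a j) (b j) (c j) (d j)) \<noteq> {}"
        using seg'[of "f i" "f j"] f_eq[of i j] fT[OF i] fT[OF j(1)] i j abcd[OF i] abcd[OF j(1)] by blast
    qed
  qed
qed

section \<open>Normalisation of slopes and heights by reflection and reversal\<close>

lemma X_scale: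
  fixes \<sigma> :: real
  assumes "\<sigma> = 1 \<or> \<sigma> = -1"
  shows "line_family.X (\<lambda>i. \<sigma> * a (g i)) (\<lambda>i. \<sigma> * b (g i)) i j = line_family.X a b (g i) (g j)"
proof -
  have "\<sigma> * (b (g j) - b (g i)) / (\<sigma> * (a (g i) - a (g j))) = (b (g j) - b (g i)) / (a (g i) - a (g j))"
    using assms by auto
  then show ?thesis by (simp only: line_family.X_def right_diff_distrib)
qed

lemma F_scale:
  fixes \<sigma> :: real
  assumes "\<sigma> = 1 \<or> \<sigma> = -1"
  shows "line_family.F (\<lambda>i. \<sigma> * a (g i)) (\<lambda>i. \<sigma> * b (g i)) (\<lambda>i. \<tau> * c (g i)) (\<lambda>i. \<tau> * d (g i)) i j =
    \<tau> * line_family.F a b c d (g i) (g j)"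
  by (simp add: line_family.F_def X_scale[OF assms] algebra_simps)

lemma monotone_cup_scaleI:
  fixes \<sigma> :: real
  assumes \<sigma>: "\<sigma> = 1 \<or> \<sigma> = -1"
    and "\<And>i j. \<lbrakk>i < j; j < n\<rbrakk> \<Longrightarrow> \<sigma> * a (g i) < \<sigma> * a (g j)"
    and "\<And>i j k x. \<lbrakk>i < j; j < k; k < n; x = line_family.X a b (g i) (g k)\<rbrakk> \<Longrightarrow>
       \<sigma> * (a (g i) * x + b (g i)) < \<sigma> * (a (g j) * x + b (g j))"
    and "\<And>i j. \<lbrakk>i < j; j < n\<rbrakk> \<Longrightarrow> \<tau> * line_family.F a b c d (g i) (g j) \<le> \<tau> * line_family.F a b c d (g j) (g i)"
  shows "monotone_cup (\<lambda>i. \<sigma> * a (g i)) (\<lambda>i. \<sigma> * b (g i)) (\<lambda>i. \<tau> * c (g i)) (\<lambda>i. \<tau> * d (g i)) n"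
  using assms(2-4) by unfold_locales (simp_all add: X_scale[OF \<sigma>] F_scale[OF \<sigma>] algebra_simps)

lemma homogeneous_orientation:
  fixes a b c d :: "nat \<Rightarrow> real" and A :: "nat \<Rightarrow> (real^2) set" and n M :: nat
  assumes ramsey: "\<forall>f :: nat \<Rightarrow> nat \<Rightarrow> nat \<Rightarrow> bool \<times> bool \<times> bool \<times> bool.
      \<exists>e v. strict_mono_on {..<n+4} e \<and> (\<forall>i<n+4. e i < M) \<and>
     (\<forall>i j k. i < j \<and> j < k \<and> k < n+4 \<longrightarrow> f (e i) (e j) (e k) = v)"
    and conv: "\<And>i. i < M \<Longrightarrow> convex (A i)"
    and disj: "\<And>i j k. \<lbrakk>i < M; j < M; k < M; i \<noteq> j; j \<noteq> k; i \<noteq> k\<rbrakk> \<Longrightarrow> A i \<inter> A j \<inter> A k = {}"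
    and meet: "\<And>i j. \<lbrakk>i < M; j < M; i \<noteq> j\<rbrakk> \<Longrightarrow> \<exists>w. w \<in> A i \<and> w \<in> A j \<and> w \<in> line2 (a i) (b i) \<and> w \<in> line2 (a j) (b j)"
  shows "\<exists>g \<sigma> \<tau>. inj_on g {..<n} \<and> (\<forall>i<n. g i < M) \<and> (\<sigma> = 1 \<or> \<sigma> = -1) \<and> (\<tau> = 1 \<or> \<tau> = -1) \<and>
    monotone_cup (\<lambda>i. \<sigma> * a (g i)) (\<lambda>i. \<sigma> * b (g i)) (\<lambda>i. \<tau> * c (g i)) (\<lambda>i. \<tau> * d (g i)) n"
proof -
  interpret line_family a b c d .
  define y where "y = (\<lambda>i x. a i * x + b i)"
  \<comment> \<open>Two strict slope comparisons leave equality as a third outcome, refuted on the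
    indices 0, 1, 2; \<open>n+4\<close> makes these and one completing index available for every
    \<open>n\<close>.\<close>
  from ramsey[rule_format, of "\<lambda>i j k. (a i < a j, a j < a i, F i j \<le> F j i, y i (X i k) < y j (X i k))"]
  obtain e v where e: "strict_mono_on {..<n+4} e" and eM: "\<forall>i<n+4. e i < M" and
    v: "\<forall>i j k. i < j \<and> j < k \<and> k < n+4 \<longrightarrow>
      (a (e i) < a (e j), a (e j) < a (e i), F (e i) (e j) \<le> F (e j) (e i),
        y (e i) (X (e i) (e k)) < y (e j) (X (e i) (e k))) = v"
    by (elim exE conjE) (rule that)
  obtain inc dec le bel where veq: "v = (inc, dec, le, bel)" by (cases v)
  have e_eq: "e i = e j \<longleftrightarrow> i = j" if "i < n+4" "j < n+4" for i j
    using strict_mono_on_imp_inj_on[OF e] that by (auto simp: inj_on_def)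
  have inc: "a (e i) < a (e j) \<longleftrightarrow> inc" and dec: "a (e j) < a (e i) \<longleftrightarrow> dec"
    and le: "F (e i) (e j) \<le> F (e j) (e i) \<longleftrightarrow> le" if "i < j" "j < n+3" for i j
    using v[rule_format, of i j "n+3"] that by (auto simp: veq)
  have bel: "y (e i) (X (e i) (e k)) < y (e j) (X (e i) (e k)) \<longleftrightarrow> bel" if "i < j" "j < k" "k < n+4" for i j k
    using v[rule_format, of i j k] that by (auto simp: veq)
  have "inc \<or> dec"
  proof (rule ccontr)
    assume no: "\<not> (inc \<or> dec)"
    then have a_eq: "a (e 0) = a (e 1)" "a (e 0) = a (e 2)"
      using inc[of 0 1] dec[of 0 1] inc[of 0 2] dec[of 0 2] by auto
    have ne: "e 0 < M" "e 1 < M" "e 2 < M" "e 0 \<noteq> e 1" "e 1 \<noteq> e 2" "e 0 \<noteq> e 2"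
      using eM e_eq[of 0 1] e_eq[of 1 2] e_eq[of 0 2] by auto
    obtain p where p: "p \<in> A (e 0)" "p \<in> A (e 1)" "p \<in> line2 (a (e 0)) (b (e 0))" "p \<in> line2 (a (e 1)) (b (e 1))"
      using meet[of "e 0" "e 1"] ne by blast
    obtain q where q: "q \<in> A (e 0)" "q \<in> A (e 2)" "q \<in> line2 (a (e 0)) (b (e 0))" "q \<in> line2 (a (e 2)) (b (e 2))"
      using meet[of "e 0" "e 2"] ne by blast
    obtain r where r: "r \<in> A (e 1)" "r \<in> A (e 2)" "r \<in> line2 (a (e 1)) (b (e 1))" "r \<in> line2 (a (e 2)) (b (e 2))"
      using meet[of "e 1" "e 2"] ne by blast
    have "b (e 0) = b (e 1)" using p a_eq by (simp add: line2_def)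
    then have "{p, q, r} \<subseteq> line2 (a (e 0)) (b (e 0))" using p q r a_eq by auto
    then have "A (e 0) \<inter> A (e 1) \<inter> A (e 2) \<noteq> {}"
      using p q r conv ne collinear_line2 by (intro collinear_pairwise_points_meet[of _ _ _ p q r]) auto
    then show False using disj ne by blast
  qed
  then have a_neq: "a (e i) \<noteq> a (e j)" if "i \<noteq> j" "i < n+3" "j < n+3" for i j
    using that inc[of i j] dec[of i j] inc[of j i] dec[of j i] by (cases i j rule: linorder_cases) auto
  have y_eq: "y (e i) x = y (e j) x \<longleftrightarrow> x = X (e i) (e j)" if "i \<noteq> j" "i < n+3" "j < n+3" for i j x
    using a_neq[OF that] by (auto simp: y_def X_def field_simps)
  have pt: "vector [X (e i) (e j), y (e i) (X (e i) (e j))] \<in> A (e i) \<inter> A (e j)" if ij: "i \<noteq> j" "i < n+3" "j < n+3" for i j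
  proof -
    obtain w where w: "w \<in> A (e i)" "w \<in> A (e j)" "w \<in> line2 (a (e i)) (b (e i))" "w \<in> line2 (a (e j)) (b (e j))"
      using meet[of "e i" "e j"] e_eq[of i j] eM ij by auto
    then have "w $ 1 = X (e i) (e j)" using y_eq[OF ij, of "w $ 1"] by (auto simp: line2_def y_def)
    then have "w = vector [X (e i) (e j), y (e i) (X (e i) (e j))]"
      using w(3) by (auto simp: line2_def y_def vec_eq_iff forall_2)
    then show ?thesis using w by auto
  qed
  have strict: "y (e i) (X (e i) (e k)) \<noteq> y (e j) (X (e i) (e k))" if ijk: "i < j" "j < k" "k < n+3" for i j k
  proof
    assume "y (e i) (X (e i) (e k)) = y (e j) (X (e i) (e k))"
    then have "X (e i) (e k) = X (e i) (e j)" using y_eq[of i j] ijk by auto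
    then have "vector [X (e i) (e j), y (e i) (X (e i) (e j))] \<in> A (e i) \<inter> A (e j) \<inter> A (e k)"
      using pt[of i j] pt[of i k] ijk by auto
    moreover have "A (e i) \<inter> A (e j) \<inter> A (e k) = {}"
      using eM e_eq[of i j] e_eq[of j k] e_eq[of i k] ijk by (intro disj) auto
    ultimately show False by blast
  qed
  define s :: real where "s = (if inc then 1 else -1)"
  define \<sigma> :: real where "\<sigma> = (if bel then 1 else -1)"
  define t :: real where "t = (if le then 1 else -1)"
  have A1: "s * a (e i) < s * a (e j)" if "i < j" "j < n+3" for i j
    using inc[OF that] dec[OF that] \<open>inc \<or> dec\<close> by (auto simp: s_def)
  have A2: "\<sigma> * y (e i) (X (e i) (e k)) < \<sigma> * y (e j) (X (e i) (e k))" if "i < j" "j < k" "k < n+3" for i j k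
    using bel[of i j k] strict[of i j k] that by (auto simp: \<sigma>_def)
  have A3: "t * F (e i) (e j) \<le> t * F (e j) (e i)" if "i < j" "j < n+3" for i j
    using le[OF that] by (auto simp: t_def)
  have \<sigma>: "\<sigma> = 1 \<or> \<sigma> = -1" and t: "t = 1 \<or> t = -1" by (auto simp: \<sigma>_def t_def)
  show ?thesis
  proof (cases "s = \<sigma>")
    case True
    have "monotone_cup (\<lambda>i. \<sigma> * a (e i)) (\<lambda>i. \<sigma> * b (e i)) (\<lambda>i. t * c (e i)) (\<lambda>i. t * d (e i)) n"
      by (rule monotone_cup_scaleI[OF \<sigma>]) (use A1 A2 A3 True in \<open>auto simp: y_def\<close>)
    moreover have "inj_on e {..<n}" using e_eq by (auto simp: inj_on_def)
    ultimately show ?thesis using eM \<sigma> t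
      by (intro exI[of _ e] exI[of _ \<sigma>] exI[of _ t]) auto
  next
    case False
    then have s: "s = - \<sigma>" by (auto simp: s_def \<sigma>_def split: if_splits)
    \<comment> \<open>Reversal flips slopes and heights but not the side of the middle line, as the
      crossing of the outer two is symmetric. It repairs the mismatch between \<open>s\<close> and
      \<sigma>, and \<tau> becomes \<open>- t\<close>.\<close>
    define g where "g = (\<lambda>i. e (n - Suc i))"
    have "monotone_cup (\<lambda>i. \<sigma> * a (g i)) (\<lambda>i. \<sigma> * b (g i)) (\<lambda>i. - t * c (g i)) (\<lambda>i. - t * d (g i)) n"
    proof (rule monotone_cup_scaleI[OF \<sigma>])
      fix i j assume ij: "i < j" "j < n"
      then have *: "n - Suc j < n - Suc i" "n - Suc i < n+3" by auto
      show "\<sigma> * a (g i) < \<sigma> * a (g j)" using A1[OF *] by (simp add: s g_def)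
      show "- t * F (g i) (g j) \<le> - t * F (g j) (g i)" using A3[OF *] by (simp add: g_def)
    next
      fix i j k x assume ijk: "i < j" "j < k" "k < n" "x = X (g i) (g k)"
      then have *: "n - Suc k < n - Suc j" "n - Suc j < n - Suc i" "n - Suc i < n+3" by auto
      have "y (g i) x = y (g k) x" using y_eq[of "n - Suc i" "n - Suc k"] * ijk(4) by (auto simp: g_def)
      then show "\<sigma> * (a (g i) * x + b (g i)) < \<sigma> * (a (g j) * x + b (g j))"
        using A2[OF *] ijk(4) X_commute[of "g i" "g k"] by (simp add: g_def y_def)
    qed
    moreover have "inj_on g {..<n}" unfolding g_def
    proof (rule inj_onI)
      fix i j assume "i \<in> {..<n}" "j \<in> {..<n}" "e (n - Suc i) = e (n - Suc j)"
      then show "i = j" using e_eq[of "n - Suc i" "n - Suc j"] by auto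
    qed
    moreover have "\<forall>i<n. g i < M" using eM by (auto simp: g_def)
    ultimately show ?thesis using \<sigma> t
      by (intro exI[of _ g] exI[of _ \<sigma>] exI[of _ "- t"]) auto
  qed
qed

lemma half_choose_two_le: "1 / 2 * real (q choose 2) \<le> real ((q div 2) * (q - q div 2))"
proof -
  define r where "r = q div 2"
  have "q = 2 * r \<or> q = 2 * r + 1" unfolding r_def by presburger
  moreover have "real (q choose 2) = real q * (real q - 1) / 2"
    by (cases q) (simp_all add: choose_two real_of_nat_div algebra_simps)
  ultimately show ?thesis
    unfolding r_def[symmetric] by (auto simp: algebra_simps power2_eq_square)
qed

lemma ex_realization:
  fixes q :: nat
  assumes q: "3 \<le> q"
  shows "\<exists>N. \<forall>K :: nat \<Rightarrow> (real^3) set.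
     (\<forall>i<N. convex (K i)) \<longrightarrow> (\<forall>i<N. \<forall>j<N. K i \<inter> K j \<noteq> {}) \<longrightarrow>
     (\<forall>i<N. \<forall>j<N. \<forall>k<N. i \<noteq> j \<and> j \<noteq> k \<and> i \<noteq> k \<longrightarrow> vproj ` K i \<inter> vproj ` K j \<inter> vproj ` K k = {}) \<longrightarrow>
     (\<exists>h l P. inj_on h {1..q} \<and> (\<forall>i\<in>{1..q}. h i < N) \<and> monotone_lines q l \<and>
       realized_by q (\<lambda>i. K (h i)) l \<and> is_plane P \<and>
       (\<forall>i\<in>{1..q div 2}. \<forall>j\<in>{q div 2<..q}. separates P (K (h i)) (K (h j))))"
proof -
  define r where "r = q div 2"
  have r: "1 \<le> r" "r < q" using q by (auto simp: r_def)
  from ex_separating_plane[OF r]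
  obtain N1 where N1: "\<forall>a b c d. monotone_cup a b c d N1 \<longrightarrow>
    (\<exists>e \<alpha> \<beta> \<gamma>. strict_mono_on {1..q} e \<and> (\<forall>i\<in>{1..q}. e i < N1) \<and>
      (\<forall>i\<in>{1..r}. \<forall>j\<in>{r<..q}. \<forall>x. x = line_family.X a b (e i) (e j) \<longrightarrow>
         c (e i) * x + d (e i) \<le> \<alpha> + \<beta> * x + \<gamma> * (a (e i) * x + b (e i)) \<and>
         \<alpha> + \<beta> * x + \<gamma> * (a (e i) * x + b (e i)) \<le> c (e j) * x + d (e j)))"
    by (rule exE)
  from ramsey_triples[of "N1+4", where ?'c = "bool \<times> bool \<times> bool \<times> bool"]
  obtain M where M: "\<forall>f :: nat \<Rightarrow> nat \<Rightarrow> nat \<Rightarrow> bool \<times> bool \<times> bool \<times> bool.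
      \<exists>e v. strict_mono_on {..<N1+4} e \<and> (\<forall>i<N1+4. e i < M) \<and>
     (\<forall>i j k. i < j \<and> j < k \<and> k < N1+4 \<longrightarrow> f (e i) (e j) (e k) = v)"
    by (rule exE)
  from ex_crossing_lines[of M]
  obtain N where N: "\<forall>K :: nat \<Rightarrow> (real^3) set.
     (\<forall>i<N. convex (K i)) \<longrightarrow> (\<forall>i<N. \<forall>j<N. K i \<inter> K j \<noteq> {}) \<longrightarrow>
     (\<forall>i<N. \<forall>j<N. \<forall>k<N. i \<noteq> j \<and> j \<noteq> k \<and> i \<noteq> k \<longrightarrow> vproj ` K i \<inter> vproj ` K j \<inter> vproj ` K k = {}) \<longrightarrow>
     (\<exists>e a b c d. inj_on e {..<M} \<and> (\<forall>i<M. e i < N) \<and>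
       (\<forall>i<M. \<forall>j<M. i \<noteq> j \<longrightarrow> vproj ` (K (e i) \<inter> line3 (a i) (b i) (c i) (d i)) \<inter>
          vproj ` (K (e j) \<inter> line3 (a j) (b j) (c j) (d j)) \<noteq> {}))"
    by (rule exE)
  show ?thesis
  proof (rule exI[of _ N], intro allI impI)
    fix K :: "nat \<Rightarrow> (real^3) set"
    assume conv: "\<forall>i<N. convex (K i)" and int: "\<forall>i<N. \<forall>j<N. K i \<inter> K j \<noteq> {}"
      and disj: "\<forall>i<N. \<forall>j<N. \<forall>k<N. i \<noteq> j \<and> j \<noteq> k \<and> i \<noteq> k \<longrightarrow> vproj ` K i \<inter> vproj ` K j \<inter> vproj ` K k = {}"
    from mp[OF mp[OF mp[OF spec[OF N, of K] conv] int] disj]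
    obtain e a b c d where e: "inj_on e {..<M}" and eN: "\<forall>i<M. e i < N" and
      meet: "\<forall>i<M. \<forall>j<M. i \<noteq> j \<longrightarrow> vproj ` (K (e i) \<inter> line3 (a i) (b i) (c i) (d i)) \<inter>
          vproj ` (K (e j) \<inter> line3 (a j) (b j) (c j) (d j)) \<noteq> {}"
      by (elim exE conjE) (rule that)
    have "\<exists>g \<sigma> \<tau>. inj_on g {..<N1} \<and> (\<forall>i<N1. g i < M) \<and> (\<sigma> = 1 \<or> \<sigma> = -1) \<and> (\<tau> = 1 \<or> \<tau> = -1) \<and>
      monotone_cup (\<lambda>i. \<sigma> * a (g i)) (\<lambda>i. \<sigma> * b (g i)) (\<lambda>i. \<tau> * c (g i)) (\<lambda>i. \<tau> * d (g i)) N1"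
    proof (rule homogeneous_orientation[OF M, where A = "\<lambda>i. vproj ` K (e i)"])
      show "convex (vproj ` K (e i))" if "i < M" for i
        using conv eN that linear_vproj convex_linear_image by blast
      show "vproj ` K (e i) \<inter> vproj ` K (e j) \<inter> vproj ` K (e k) = {}"
        if "i < M" "j < M" "k < M" "i \<noteq> j" "j \<noteq> k" "i \<noteq> k" for i j k
        using that eN inj_onD[OF e, of i j] inj_onD[OF e, of j k] inj_onD[OF e, of i k]
        by (intro disj[rule_format]) auto
      show "\<exists>w. w \<in> vproj ` K (e i) \<and> w \<in> vproj ` K (e j) \<and> w \<in> line2 (a i) (b i) \<and> w \<in> line2 (a j) (b j)"
        if "i < M" "j < M" "i \<noteq> j" for i j
      proof -
        from meet[rule_format, OF that]
        obtain w where "w \<in> vproj ` (K (e i) \<inter> line3 (a i) (b i) (c i) (d i)) \<inter>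
            vproj ` (K (e j) \<inter> line3 (a j) (b j) (c j) (d j))"
          unfolding ex_in_conv[symmetric] by (rule exE)
        then have "w \<in> vproj ` K (e i) \<inter> vproj ` line3 (a i) (b i) (c i) (d i)"
          "w \<in> vproj ` K (e j) \<inter> vproj ` line3 (a j) (b j) (c j) (d j)"
          by (auto intro!: subsetD[OF image_Int_subset])
        then show ?thesis by (auto simp: vproj_line3)
      qed
    qed
    then obtain g \<sigma> \<tau> where g: "inj_on g {..<N1}" and gM: "\<forall>i<N1. g i < M" and \<sigma>: "\<sigma> = 1 \<or> \<sigma> = -1" and \<tau>: "\<tau> = 1 \<or> \<tau> = -1" and
      mc: "monotone_cup (\<lambda>i. \<sigma> * a (g i)) (\<lambda>i. \<sigma> * b (g i)) (\<lambda>i. \<tau> * c (g i)) (\<lambda>i. \<tau> * d (g i)) N1"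
      by (elim exE conjE) (rule that)
    from N1[THEN spec, THEN spec, THEN spec, THEN spec, THEN mp, OF mc]
    obtain f \<alpha> \<beta> \<gamma> where f: "strict_mono_on {1..q} f" and fN: "\<forall>i\<in>{1..q}. f i < N1" and
      sep: "\<forall>i\<in>{1..r}. \<forall>j\<in>{r<..q}. \<forall>x. x = line_family.X (\<lambda>i. \<sigma> * a (g i)) (\<lambda>i. \<sigma> * b (g i)) (f i) (f j) \<longrightarrow>
         \<tau> * c (g (f i)) * x + \<tau> * d (g (f i)) \<le> \<alpha> + \<beta> * x + \<gamma> * (\<sigma> * a (g (f i)) * x + \<sigma> * b (g (f i))) \<and>
         \<alpha> + \<beta> * x + \<gamma> * (\<sigma> * a (g (f i)) * x + \<sigma> * b (g (f i))) \<le> \<tau> * c (g (f j)) * x + \<tau> * d (g (f j))"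
      by (elim exE conjE) (rule that)
    define a' where "a' = (\<lambda>i. a (g (f i)))"
    define b' where "b' = (\<lambda>i. b (g (f i)))"
    define c' where "c' = (\<lambda>i. c (g (f i)))"
    define d' where "d' = (\<lambda>i. d (g (f i)))"
    define h where "h = (\<lambda>i. e (g (f i)))"
    define l where "l = (\<lambda>i. line3 (a' i) (b' i) (c' i) (d' i))"
    \<comment> \<open>The plane of the reflected lines, \<tau> z = \<alpha> + \<beta> x + \<gamma>
      \<sigma> y, solved for z with \<tau> * \<tau> = 1.\<close>
    define P where "P = plane3 (\<tau> * \<alpha>) (\<tau> * \<beta>) (\<tau> * \<gamma> * \<sigma>)"
    have X: "line_family.X (\<lambda>i. \<sigma> * a (g i)) (\<lambda>i. \<sigma> * b (g i)) (f i) (f j) = line_family.X a' b' i j" for i j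
      unfolding X_scale[OF \<sigma>] by (simp add: line_family.X_def a'_def b'_def)
    have F: "line_family.F (\<lambda>i. \<sigma> * a (g i)) (\<lambda>i. \<sigma> * b (g i)) (\<lambda>i. \<tau> * c (g i)) (\<lambda>i. \<tau> * d (g i)) (f i) (f j) =
        \<tau> * line_family.F a' b' c' d' i j" for i j
      unfolding F_scale[OF \<sigma>] by (simp add: line_family.F_def line_family.X_def a'_def b'_def c'_def d'_def)
    have f_less: "f i < f j" "f j < N1" if "1 \<le> i" "i < j" "j \<le> q" for i j
      using f fN that by (auto simp: strict_mono_on_def)
    have gf: "g (f i) < M" if "i \<in> {1..q}" for i using fN gM that by auto
    have gf_eq: "g (f i) = g (f j) \<longleftrightarrow> i = j" if "i \<in> {1..q}" "j \<in> {1..q}" for i j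
      using inj_onD[OF g, of "f i" "f j"] inj_onD[OF strict_mono_on_imp_inj_on[OF f], of i j] fN that by auto
    have h: "inj_on h {1..q}"
    proof (rule inj_onI)
      fix i j assume "i \<in> {1..q}" "j \<in> {1..q}" "h i = h j"
      then show "i = j" using inj_onD[OF e, of "g (f i)" "g (f j)"] gf gf_eq by (auto simp: h_def)
    qed
    have hN: "\<forall>i\<in>{1..q}. h i < N" using gf eN by (auto simp: h_def)
    have a': "\<sigma> * a' i < \<sigma> * a' j" if "1 \<le> i" "i < j" "j \<le> q" for i j
      using monotone_cup.a_less[OF mc f_less[OF that]] by (simp add: a'_def)
    have mono: "monotone_lines q l"
      unfolding l_def
    proof (rule monotone_lines_line3[OF q \<sigma> \<tau>])
      show "\<sigma> * a' i < \<sigma> * a' j" if "1 \<le> i" "i < j" "j \<le> q" for i j by (rule a'[OF that])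
      show "\<sigma> * (a' i * x + b' i) < \<sigma> * (a' j * x + b' j)"
        if "1 \<le> i" "i < j" "j < k" "k \<le> q" "x = line_family.X a' b' i k" for i j k x
        using monotone_cup.cup[OF mc, of "f i" "f j" "f k"] f_less[of i j] f_less[of j k] that
        unfolding X by (simp add: a'_def b'_def algebra_simps)
      show "\<tau> * line_family.F a' b' c' d' i j \<le> \<tau> * line_family.F a' b' c' d' j i" if "1 \<le> i" "i < j" "j \<le> q" for i j
        using monotone_cup.F_le[OF mc f_less[OF that]] unfolding F .
    qed
    have meet': "vproj ` (K (h i) \<inter> l i) \<inter> vproj ` (K (h j) \<inter> l j) \<noteq> {}" if "i \<in> {1..q}" "j \<in> {1..q}" "i \<noteq> j" for i j
      using meet[rule_format, of "g (f i)" "g (f j)"] gf gf_eq that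
      by (simp add: h_def l_def a'_def b'_def c'_def d'_def)
    have a'_neq: "a' i \<noteq> a' j" if "1 \<le> i" "i < j" "j \<le> q" for i j
      using a'[OF that] by auto
    have real: "realized_by q (\<lambda>i. K (h i)) l"
      unfolding realized_by_def
    proof (intro conjI ballI impI)
      fix i assume i: "i \<in> {1..q}"
      show "nonvertical3 (l i)" by (simp add: l_def nonvertical3_line3)
      fix j assume j: "j \<in> {1..q}" "i < j"
      show "\<not> affine_parallel (vproj ` l i) (vproj ` l j)"
        using affine_parallel_line2 a'_neq[of i j] i j by (auto simp: l_def vproj_line3)
      show "vproj ` (K (h i) \<inter> l i) \<inter> vproj ` (K (h j) \<inter> l j) \<noteq> {}"
        using meet'[of i j] i j by auto
    qed
    have "separates P (K (h i)) (K (h j))" if i: "i \<in> {1..r}" and j: "j \<in> {r<..q}" for i j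
    proof -
      have ij: "1 \<le> i" "i < j" "j \<le> q" using i j by auto
      obtain u v where u: "u \<in> K (h i)" "u \<in> l i" and v: "v \<in> K (h j)" "v \<in> l j" and uv: "vproj u = vproj v"
        using meet'[of i j] ij by auto
      define x where "x = u $ 1"
      have "v $ 1 = x" "v $ 2 = u $ 2" using uv by (metis vproj_nth(1) x_def, metis vproj_nth(2))
      then have *: "u $ 2 = a' i * x + b' i" "u $ 3 = c' i * x + d' i" "v $ 3 = c' j * x + d' j" "u $ 2 = a' j * x + b' j"
        using u(2) v(2) by (auto simp: l_def line3_def x_def)
      then have "x = line_family.X a' b' i j"
        using a'_neq[OF ij] by (simp add: line_family.X_def field_simps)
      then have s: "\<tau> * (u $ 3) \<le> \<alpha> + \<beta> * x + \<gamma> * \<sigma> * (u $ 2)" "\<alpha> + \<beta> * x + \<gamma> * \<sigma> * (u $ 2) \<le> \<tau> * (v $ 3)"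
        using sep[rule_format, OF i j, of x] unfolding X * by (simp_all add: a'_def b'_def c'_def d'_def algebra_simps)
      show ?thesis
        unfolding P_def
      proof (rule separates_plane3[OF u(1) v(1) uv])
        show "u $ 3 \<le> \<tau> * (\<alpha> + \<beta> * x + \<gamma> * \<sigma> * (u $ 2)) \<and> \<tau> * (\<alpha> + \<beta> * x + \<gamma> * \<sigma> * (u $ 2)) \<le> v $ 3 \<or>
          v $ 3 \<le> \<tau> * (\<alpha> + \<beta> * x + \<gamma> * \<sigma> * (u $ 2)) \<and> \<tau> * (\<alpha> + \<beta> * x + \<gamma> * \<sigma> * (u $ 2)) \<le> u $ 3"
          using s \<tau> by auto
      qed (simp add: x_def algebra_simps)
    qed
    then show "\<exists>h l P. inj_on h {1..q} \<and> (\<forall>i\<in>{1..q}. h i < N) \<and> monotone_lines q l \<and>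
       realized_by q (\<lambda>i. K (h i)) l \<and> is_plane P \<and>
       (\<forall>i\<in>{1..q div 2}. \<forall>j\<in>{q div 2<..q}. separates P (K (h i)) (K (h j)))"
      using h hN mono real is_plane_plane3 unfolding r_def P_def by blast
  qed
qed

theorem theorem3p1:
  "\<exists>c::real. c > 0 \<and> (\<forall>q::nat. q \<ge> 3 \<longrightarrow> (\<exists>p::nat. p \<ge> q \<and>
     (\<forall>\<K> :: (real^3) set set.
        (\<forall>K\<in>\<K>. convex K) \<and> pairwise (\<lambda>A B. A \<inter> B \<noteq> {}) \<K> \<longrightarrow>
        (\<forall>\<A>. \<A> \<subseteq> \<K> \<and> finite \<A> \<and> card \<A> = p \<longrightarrow>
           (\<exists>A\<in>\<A>. \<exists>B\<in>\<A>. \<exists>C\<in>\<A>. A \<noteq> B \<and> A \<noteq> C \<and> B \<noteq> C \<and>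
              vproj ` A \<inter> vproj ` B \<inter> vproj ` C \<noteq> {}) \<or>
           (\<exists>(K :: nat \<Rightarrow> (real^3) set) (l :: nat \<Rightarrow> (real^3) set) P.
              inj_on K {1..q} \<and> K ` {1..q} \<subseteq> \<A> \<and>
              monotone_lines q l \<and> realized_by q K l \<and> is_plane P \<and>
              real (card {(i, j). i \<in> {1..q} \<and> j \<in> {1..q} \<and> i < j \<and> separates P (K i) (K j)})
                \<ge> c * real (q choose 2))))))"
proof (rule exI[of _ "1/2"], intro conjI allI impI)
  fix q :: nat
  assume q: "3 \<le> q"
  from ex_realization[OF q]
  obtain N where N: "\<forall>K :: nat \<Rightarrow> (real^3) set.
     (\<forall>i<N. convex (K i)) \<longrightarrow> (\<forall>i<N. \<forall>j<N. K i \<inter> K j \<noteq> {}) \<longrightarrow>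
     (\<forall>i<N. \<forall>j<N. \<forall>k<N. i \<noteq> j \<and> j \<noteq> k \<and> i \<noteq> k \<longrightarrow> vproj ` K i \<inter> vproj ` K j \<inter> vproj ` K k = {}) \<longrightarrow>
     (\<exists>h l P. inj_on h {1..q} \<and> (\<forall>i\<in>{1..q}. h i < N) \<and> monotone_lines q l \<and>
       realized_by q (\<lambda>i. K (h i)) l \<and> is_plane P \<and>
       (\<forall>i\<in>{1..q div 2}. \<forall>j\<in>{q div 2<..q}. separates P (K (h i)) (K (h j))))"
    by (rule exE)
  show "\<exists>p::nat. p \<ge> q \<and>
     (\<forall>\<K> :: (real^3) set set.
        (\<forall>K\<in>\<K>. convex K) \<and> pairwise (\<lambda>A B. A \<inter> B \<noteq> {}) \<K> \<longrightarrow>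
        (\<forall>\<A>. \<A> \<subseteq> \<K> \<and> finite \<A> \<and> card \<A> = p \<longrightarrow>
           (\<exists>A\<in>\<A>. \<exists>B\<in>\<A>. \<exists>C\<in>\<A>. A \<noteq> B \<and> A \<noteq> C \<and> B \<noteq> C \<and>
              vproj ` A \<inter> vproj ` B \<inter> vproj ` C \<noteq> {}) \<or>
           (\<exists>(K :: nat \<Rightarrow> (real^3) set) (l :: nat \<Rightarrow> (real^3) set) P.
              inj_on K {1..q} \<and> K ` {1..q} \<subseteq> \<A> \<and>
              monotone_lines q l \<and> realized_by q K l \<and> is_plane P \<and>
              real (card {(i, j). i \<in> {1..q} \<and> j \<in> {1..q} \<and> i < j \<and> separates P (K i) (K j)})
                \<ge> 1/2 * real (q choose 2))))"
  proof (rule exI[of _ "max q N"], intro conjI allI impI, goal_cases)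
    case (2 \<K> \<A>)
    then have conv: "\<And>K. K \<in> \<A> \<Longrightarrow> convex K" and card: "finite \<A>" "card \<A> = max q N"
      and int: "\<And>A B. \<lbrakk>A \<in> \<A>; B \<in> \<A>; A \<noteq> B\<rbrakk> \<Longrightarrow> A \<inter> B \<noteq> {}"
      by (auto simp: pairwise_def)
    show ?case
    proof (subst disj_commute, rule disjCI)
      assume no: "\<not> (\<exists>A\<in>\<A>. \<exists>B\<in>\<A>. \<exists>C\<in>\<A>. A \<noteq> B \<and> A \<noteq> C \<and> B \<noteq> C \<and>
              vproj ` A \<inter> vproj ` B \<inter> vproj ` C \<noteq> {})"
      obtain K where K: "bij_betw K {..<max q N} \<A>"
        using ex_bij_betw_nat_finite[OF card(1)] card(2) by (auto simp: atLeast0LessThan)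
      have KA: "K i \<in> \<A>" if "i < max q N" for i using K that by (auto simp: bij_betw_def)
      have K_eq: "K i = K j \<longleftrightarrow> i = j" if "i < max q N" "j < max q N" for i j
        using K that by (auto simp: bij_betw_def inj_on_def)
      \<comment> \<open>\<open>pairwise\<close> speaks of distinct sets only; the case of equal
        indices in \<open>c2\<close> needs nonemptiness, which follows from meeting another
        member.\<close>
      have ne: "K i \<noteq> {}" if "i < max q N" for i
      proof -
        obtain j where "j < max q N" "j \<noteq> i"
          using q by (cases "i = 0") (auto intro: that[of 0] that[of 1])
        then show ?thesis using int[OF KA[OF that] KA[of j]] K_eq[of i j] that by auto
      qed
      have c1: "\<forall>i<N. convex (K i)" using conv KA by auto
      have c2: "\<forall>i<N. \<forall>j<N. K i \<inter> K j \<noteq> {}"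
      proof (intro allI impI)
        fix i j assume "i < N" "j < N"
        then show "K i \<inter> K j \<noteq> {}"
          using int[of "K i" "K j"] KA[of i] KA[of j] ne[of i] by (cases "K i = K j") auto
      qed
      have c3: "\<forall>i<N. \<forall>j<N. \<forall>k<N. i \<noteq> j \<and> j \<noteq> k \<and> i \<noteq> k \<longrightarrow> vproj ` K i \<inter> vproj ` K j \<inter> vproj ` K k = {}"
      proof (intro allI impI)
        fix i j k assume ijk: "i < N" "j < N" "k < N" "i \<noteq> j \<and> j \<noteq> k \<and> i \<noteq> k"
        then have "K i \<noteq> K j" "K j \<noteq> K k" "K i \<noteq> K k" "K i \<in> \<A>" "K j \<in> \<A>" "K k \<in> \<A>"
          using K_eq[of i j] K_eq[of j k] K_eq[of i k] KA by auto
        then show "vproj ` K i \<inter> vproj ` K j \<inter> vproj ` K k = {}" using no by blast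
      qed
      from mp[OF mp[OF mp[OF spec[OF N, of K] c1] c2] c3]
      obtain h l P where h: "inj_on h {1..q}" "\<forall>i\<in>{1..q}. h i < N" and m: "monotone_lines q l"
        "realized_by q (\<lambda>i. K (h i)) l" "is_plane P" and
        sep: "\<forall>i\<in>{1..q div 2}. \<forall>j\<in>{q div 2<..q}. separates P (K (h i)) (K (h j))"
        by (elim exE conjE) (rule that)
      have inj: "inj_on (\<lambda>i. K (h i)) {1..q}"
      proof (rule inj_onI)
        fix i j assume "i \<in> {1..q}" "j \<in> {1..q}" "K (h i) = K (h j)"
        then show "i = j" using K_eq[of "h i" "h j"] bspec[OF h(2), of i] bspec[OF h(2), of j] inj_onD[OF h(1), of i j]
          by (auto simp: less_max_iff_disj)
      qed
      have sub: "(\<lambda>i. K (h i)) ` {1..q} \<subseteq> \<A>" using h(2) KA by (auto simp: less_max_iff_disj)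
      let ?S = "{(i, j). i \<in> {1..q} \<and> j \<in> {1..q} \<and> i < j \<and> separates P (K (h i)) (K (h j))}"
      have "finite ?S" by (rule finite_subset[of _ "{1..q} \<times> {1..q}"]) auto
      moreover have "{1..q div 2} \<times> {q div 2<..q} \<subseteq> ?S" using sep by auto
      ultimately have "card ({1..q div 2} \<times> {q div 2<..q}) \<le> card ?S" by (rule card_mono)
      then have "(q div 2) * (q - q div 2) \<le> card ?S" by (simp add: card_cartesian_product)
      then have "real ((q div 2) * (q - q div 2)) \<le> real (card ?S)" by (rule of_nat_mono)
      with half_choose_two_le[of q] have "1/2 * real (q choose 2) \<le> real (card ?S)" by linarith
      then show "\<exists>(K :: nat \<Rightarrow> (real^3) set) (l :: nat \<Rightarrow> (real^3) set) P.
              inj_on K {1..q} \<and> K ` {1..q} \<subseteq> \<A> \<and>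
              monotone_lines q l \<and> realized_by q K l \<and> is_plane P \<and>
              real (card {(i, j). i \<in> {1..q} \<and> j \<in> {1..q} \<and> i < j \<and> separates P (K i) (K j)})
                \<ge> 1/2 * real (q choose 2)"
        using inj sub m by (intro exI[of _ "\<lambda>i. K (h i)"] exI[of _ l] exI[of _ P] conjI)
    qed
  qed simp
qed simp

end
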